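(* Let $\mathcal I$ be a layered ideal on a set $I$, and let $M_i$ ($i\in I$) be structures in a common countable language such that the theory of $M=\prod_i M_i/\mathcal I$ is stable. Then $M$ is $\mathfrak c$-saturated. In particular, if $|M_i|\leq\mathfrak c$ for every $i$, then $M$ is saturated.
   Context: An ideal $\mathcal I$ on $I$ is layered if $I$ is the union of countably many sets in $\mathcal I$ and there is $\mu\colon\mathcal P(I)\to[0,\infty]$ such that $A\subseteq B$ implies $\mu(A)\le\mu(B)$, $\mathcal I=\{A:\mu(A)<\infty\}$, and $A\notin\mathcal I$ iff $\sup\{\mu(B):B\subseteq A,B\in\mathcal I\}=\infty$. Reduced product: $\prod_iM_i$ modulo $(a_i)\sim(b_i)\iff\{i:a_i\ne b_i\}\in\mathcal I$, functions coordinatewise, relations holding iff they fail on a set in $\mathcal I$. $\mathfrak c=2^{\aleph_0}$. $\kappa$-saturated: every consistent set of formulas in one free variable with parameters from a set of size $<\kappa$ is realised; saturated: $|M|$-saturated. A complete theory is stable if no formula $\varphi(\bar x,\bar y)$ has the order property (for every $k$ there are $\bar a_i,\bar b_i$, $i<k$, in a model with $\varphi(\bar a_i,\bar b_j)$ iff $i\le j$).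
   Formalization: The second claim (M is saturated if all |M_i| ≤ 𝔠) is stated under the extra hypothesis 2^|I| ≤ 𝔠 (automatic for countable I); without a bound on I it is false, since M may have more than 𝔠 elements while a definable infinite set has only 𝔠. *)

theory Defs
  imports
    Complex_Main
    "HOL-Library.FuncSet"
    "HOL-Library.Countable_Set"
    "HOL-Library.Equipollence"
    "HOL-Library.Extended_Nonnegative_Real"
begin

subsection \<open>First-order logic\<close>

text \<open>Constants are function symbols of arity 0; equality is a logical symbol.\<close>

record ('f, 'r) language =
  funs :: "'f set"
  fun_arity :: "'f \<Rightarrow> nat"
  rels :: "'r set"
  rel_arity :: "'r \<Rightarrow> nat"

definition countable_language :: "('f, 'r) language \<Rightarrow> bool" where
  "countable_language L \<longleftrightarrow> countable (funs L) \<and> countable (rels L)"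

datatype 'f tm = Var nat | App 'f "'f tm list"

datatype ('f, 'r) fm =
    Eql "'f tm" "'f tm"
  | Rel 'r "'f tm list"
  | Neg "('f, 'r) fm"
  | Conj "('f, 'r) fm" "('f, 'r) fm"
  | Exists nat "('f, 'r) fm"

fun wf_tm :: "('f, 'r) language \<Rightarrow> 'f tm \<Rightarrow> bool" where
  "wf_tm L (Var n) \<longleftrightarrow> True"
| "wf_tm L (App f ts) \<longleftrightarrow> f \<in> funs L \<and> length ts = fun_arity L f \<and> (\<forall>t\<in>set ts. wf_tm L t)"

fun wf_fm :: "('f, 'r) language \<Rightarrow> ('f, 'r) fm \<Rightarrow> bool" where
  "wf_fm L (Eql s t) \<longleftrightarrow> wf_tm L s \<and> wf_tm L t"
| "wf_fm L (Rel r ts) \<longleftrightarrow> r \<in> rels L \<and> length ts = rel_arity L r \<and> (\<forall>t\<in>set ts. wf_tm L t)"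
| "wf_fm L (Neg p) \<longleftrightarrow> wf_fm L p"
| "wf_fm L (Conj p q) \<longleftrightarrow> wf_fm L p \<and> wf_fm L q"
| "wf_fm L (Exists n p) \<longleftrightarrow> wf_fm L p"

fun fv_tm :: "'f tm \<Rightarrow> nat set" where
  "fv_tm (Var n) = {n}"
| "fv_tm (App f ts) = (\<Union>t\<in>set ts. fv_tm t)"

fun fv :: "('f, 'r) fm \<Rightarrow> nat set" where
  "fv (Eql s t) = fv_tm s \<union> fv_tm t"
| "fv (Rel r ts) = (\<Union>t\<in>set ts. fv_tm t)"
| "fv (Neg p) = fv p"
| "fv (Conj p q) = fv p \<union> fv q"
| "fv (Exists n p) = fv p - {n}"

record ('f, 'r, 'a) struct =
  universe :: "'a set"
  fun_interp :: "'f \<Rightarrow> 'a list \<Rightarrow> 'a"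
  rel_interp :: "'r \<Rightarrow> 'a list \<Rightarrow> bool"

definition is_structure :: "('f, 'r) language \<Rightarrow> ('f, 'r, 'a) struct \<Rightarrow> bool" where
  "is_structure L M \<longleftrightarrow> universe M \<noteq> {} \<and>
    (\<forall>f\<in>funs L. \<forall>as\<in>lists (universe M). length as = fun_arity L f \<longrightarrow> fun_interp M f as \<in> universe M)"

fun eval_tm :: "('f, 'r, 'a) struct \<Rightarrow> (nat \<Rightarrow> 'a) \<Rightarrow> 'f tm \<Rightarrow> 'a" where
  "eval_tm M e (Var n) = e n"
| "eval_tm M e (App f ts) = fun_interp M f (map (eval_tm M e) ts)"

fun sat :: "('f, 'r, 'a) struct \<Rightarrow> (nat \<Rightarrow> 'a) \<Rightarrow> ('f, 'r) fm \<Rightarrow> bool" where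
  "sat M e (Eql s t) \<longleftrightarrow> eval_tm M e s = eval_tm M e t"
| "sat M e (Rel r ts) \<longleftrightarrow> rel_interp M r (map (eval_tm M e) ts)"
| "sat M e (Neg p) \<longleftrightarrow> \<not> sat M e p"
| "sat M e (Conj p q) \<longleftrightarrow> sat M e p \<and> sat M e q"
| "sat M e (Exists n p) \<longleftrightarrow> (\<exists>a\<in>universe M. sat M (e(n := a)) p)"

definition theory_of :: "('f, 'r) language \<Rightarrow> ('f, 'r, 'a) struct \<Rightarrow> ('f, 'r) fm set" where
  "theory_of L M = {p. wf_fm L p \<and> fv p = {} \<and> (\<forall>e. range e \<subseteq> universe M \<longrightarrow> sat M e p)}"

definition is_model :: "('f, 'r) language \<Rightarrow> ('f, 'r) fm set \<Rightarrow> ('f, 'r, 'a) struct \<Rightarrow> bool" where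
  "is_model L T N \<longleftrightarrow> is_structure L N \<and> (\<forall>p\<in>T. \<forall>e. range e \<subseteq> universe N \<longrightarrow> sat N e p)"


subsection \<open>Stability\<close>

text \<open>
  A partitioned formula \<open>\<phi>(x, y)\<close> is a formula \<open>p\<close> with a set \<open>X\<close> of variables: the tuple \<open>x\<close>
  consists of the free variables of \<open>p\<close> in \<open>X\<close>, the tuple \<open>y\<close> of the remaining ones. The tuples
  \<open>a i\<close> and \<open>b j\<close> are given as assignments, read off on the respective variables only.

  HOL cannot quantify over types inside a formula, so the models range over structures
  with elements in a type \<open>'u\<close>, passed as a parameter. For a complete theory the choice is immaterial
  as long as the theory has a model in \<open>'u\<close>: for each \<open>k\<close>, the existence of the required tuples is
  expressed by a sentence, so it holds in one model iff it holds in all of them.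
\<close>

definition order_property ::
    "'u itself \<Rightarrow> ('f, 'r) language \<Rightarrow> ('f, 'r) fm set \<Rightarrow> nat set \<Rightarrow> ('f, 'r) fm \<Rightarrow> bool" where
  "order_property U L T X p \<longleftrightarrow>
    (\<forall>k. \<exists>(N :: ('f, 'r, 'u) struct) a b. is_model L T N \<and>
      (\<forall>i<k. range (a i) \<subseteq> universe N \<and> range (b i) \<subseteq> universe N) \<and>
      (\<forall>i<k. \<forall>j<k. sat N (override_on (b j) (a i) X) p \<longleftrightarrow> i \<le> (j::nat)))"

definition stable :: "'u itself \<Rightarrow> ('f, 'r) language \<Rightarrow> ('f, 'r) fm set \<Rightarrow> bool" where
  "stable U L T \<longleftrightarrow> \<not> (\<exists>X p. wf_fm L p \<and> order_property U L T X p)"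


subsection \<open>Saturation\<close>

text \<open>
  A formula in the free variable \<open>Var 0\<close> with parameters from \<open>A\<close> is a pair \<open>(p, e)\<close> where \<open>e\<close>
  assigns parameters to the other free variables of \<open>p\<close>.
\<close>

definition param_fms ::
    "('f, 'r) language \<Rightarrow> 'a set \<Rightarrow> (('f, 'r) fm \<times> (nat \<Rightarrow> 'a)) set" where
  "param_fms L A = {(p, e). wf_fm L p \<and> (\<forall>v\<in>fv p - {0}. e v \<in> A)}"

definition realises ::
    "('f, 'r, 'a) struct \<Rightarrow> 'a \<Rightarrow> (('f, 'r) fm \<times> (nat \<Rightarrow> 'a)) set \<Rightarrow> bool" where
  "realises M c P \<longleftrightarrow> c \<in> universe M \<and> (\<forall>(p, e)\<in>P. sat M (e(0 := c)) p)"

text \<open>Consistency is with respect to the theory of \<open>M\<close> with its parameters named.\<close>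

definition consistent ::
    "('f, 'r, 'a) struct \<Rightarrow> (('f, 'r) fm \<times> (nat \<Rightarrow> 'a)) set \<Rightarrow> bool" where
  "consistent M P \<longleftrightarrow> (\<forall>Q. finite Q \<and> Q \<subseteq> P \<longrightarrow> (\<exists>c. realises M c Q))"

text \<open>The cardinal \<open>\<kappa>\<close> is represented by any set \<open>K\<close> of that cardinality.\<close>

definition card_saturated ::
    "('f, 'r) language \<Rightarrow> 'k set \<Rightarrow> ('f, 'r, 'a) struct \<Rightarrow> bool" where
  "card_saturated L K M \<longleftrightarrow>
    (\<forall>A P. A \<subseteq> universe M \<and> A \<prec> K \<and> P \<subseteq> param_fms L A \<and> consistent M P \<longrightarrow> (\<exists>c. realises M c P))"

definition saturated :: "('f, 'r) language \<Rightarrow> ('f, 'r, 'a) struct \<Rightarrow> bool" where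
  "saturated L M \<longleftrightarrow> card_saturated L (universe M) M"

abbreviation continuum :: "nat set set" where
  "continuum \<equiv> UNIV"


subsection \<open>Layered ideals\<close>

definition ideal_on :: "'i set \<Rightarrow> 'i set set \<Rightarrow> bool" where
  "ideal_on I J \<longleftrightarrow> J \<subseteq> Pow I \<and> {} \<in> J \<and> (\<forall>A\<in>J. \<forall>B\<subseteq>A. B \<in> J) \<and> (\<forall>A\<in>J. \<forall>B\<in>J. A \<union> B \<in> J)"

definition layered :: "'i set \<Rightarrow> 'i set set \<Rightarrow> bool" where
  "layered I J \<longleftrightarrow> ideal_on I J \<and>
    (\<exists>C\<subseteq>J. countable C \<and> \<Union>C = I) \<and>
    (\<exists>\<mu> :: 'i set \<Rightarrow> ennreal.
      (\<forall>A B. A \<subseteq> B \<and> B \<subseteq> I \<longrightarrow> \<mu> A \<le> \<mu> B) \<and>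
      J = {A. A \<subseteq> I \<and> \<mu> A < \<infinity>} \<and>
      (\<forall>A\<subseteq>I. A \<notin> J \<longleftrightarrow> (SUP B \<in> {B. B \<subseteq> A \<and> B \<in> J}. \<mu> B) = \<infinity>))"


subsection \<open>Reduced products\<close>

definition red_rel ::
    "'i set \<Rightarrow> 'i set set \<Rightarrow> ('i \<Rightarrow> ('f, 'r, 'a) struct) \<Rightarrow> ('i \<Rightarrow> 'a) rel" where
  "red_rel I J M = {(a, b). a \<in> (\<Pi>\<^sub>E i\<in>I. universe (M i)) \<and> b \<in> (\<Pi>\<^sub>E i\<in>I. universe (M i)) \<and>
    {i \<in> I. a i \<noteq> b i} \<in> J}"

text \<open>The interpretations do not depend on the representatives picked by \<open>red_rep\<close>; see below.\<close>

definition red_rep :: "('i \<Rightarrow> 'a) set \<Rightarrow> 'i \<Rightarrow> 'a" where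
  "red_rep c = (SOME a. a \<in> c)"

definition reduced_product ::
    "'i set \<Rightarrow> 'i set set \<Rightarrow> ('i \<Rightarrow> ('f, 'r, 'a) struct) \<Rightarrow> ('f, 'r, ('i \<Rightarrow> 'a) set) struct" where
  "reduced_product I J M = \<lparr>
    universe = (\<Pi>\<^sub>E i\<in>I. universe (M i)) // red_rel I J M,
    fun_interp = (\<lambda>f cs. red_rel I J M `` {\<lambda>i\<in>I. fun_interp (M i) f (map (\<lambda>c. red_rep c i) cs)}),
    rel_interp = (\<lambda>r cs. {i \<in> I. \<not> rel_interp (M i) r (map (\<lambda>c. red_rep c i) cs)} \<in> J)\<rparr>"

lemma equiv_red_rel:
  assumes "ideal_on I J"
  shows "equiv (\<Pi>\<^sub>E i\<in>I. universe (M i)) (red_rel I J M)"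
proof (rule equivI)
  show "red_rel I J M \<subseteq> (\<Pi>\<^sub>E i\<in>I. universe (M i)) \<times> (\<Pi>\<^sub>E i\<in>I. universe (M i))"
    by (auto simp: red_rel_def)
  show "refl_on (\<Pi>\<^sub>E i\<in>I. universe (M i)) (red_rel I J M)"
    using assms by (auto simp: red_rel_def refl_on_def ideal_on_def)
  show "sym (red_rel I J M)"
    by (auto simp: red_rel_def sym_def eq_commute)
  show "trans (red_rel I J M)"
  proof (rule transI)
    fix a b c
    assume *: "(a, b) \<in> red_rel I J M" "(b, c) \<in> red_rel I J M"
    then have "{i \<in> I. a i \<noteq> b i} \<union> {i \<in> I. b i \<noteq> c i} \<in> J"
      using assms by (auto simp: red_rel_def ideal_on_def)
    moreover have "{i \<in> I. a i \<noteq> c i} \<subseteq> {i \<in> I. a i \<noteq> b i} \<union> {i \<in> I. b i \<noteq> c i}"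
      by auto
    ultimately have "{i \<in> I. a i \<noteq> c i} \<in> J"
      using assms unfolding ideal_on_def by blast
    with * show "(a, c) \<in> red_rel I J M"
      by (auto simp: red_rel_def)
  qed
qed

lemma red_rep_diff:
  assumes J: "ideal_on I J"
    and as: "as \<in> lists (\<Pi>\<^sub>E i\<in>I. universe (M i))"
  shows "{i \<in> I. map (\<lambda>c. red_rep c i) (map (\<lambda>a. red_rel I J M `` {a}) as) \<noteq> map (\<lambda>a. a i) as} \<in> J"
  using as
proof (induction as)
  case Nil
  then show ?case using J by (simp add: ideal_on_def)
next
  case (Cons a as)
  let ?c = "red_rel I J M `` {a}"
  have "a \<in> ?c"
    using Cons.hyps by (intro equiv_class_self[OF equiv_red_rel[OF J]])
  then have "red_rep ?c \<in> ?c"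
    unfolding red_rep_def by (rule someI[where P = "\<lambda>b. b \<in> red_rel I J M `` {a}"])
  moreover have "{i \<in> I. a i \<noteq> b i} \<in> J" if "b \<in> ?c" for b
    using that by (simp add: red_rel_def)
  ultimately have "{i \<in> I. a i \<noteq> red_rep ?c i} \<in> J" by blast
  with Cons.IH have "{i \<in> I. a i \<noteq> red_rep ?c i} \<union>
      {i \<in> I. map (\<lambda>c. red_rep c i) (map (\<lambda>a. red_rel I J M `` {a}) as) \<noteq> map (\<lambda>a. a i) as} \<in> J"
    using J unfolding ideal_on_def by blast
  moreover have "{i \<in> I. map (\<lambda>c. red_rep c i) (map (\<lambda>a. red_rel I J M `` {a}) (a # as))
        \<noteq> map (\<lambda>a. a i) (a # as)} \<subseteq>
      {i \<in> I. a i \<noteq> red_rep ?c i} \<union>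
      {i \<in> I. map (\<lambda>c. red_rep c i) (map (\<lambda>a. red_rel I J M `` {a}) as) \<noteq> map (\<lambda>a. a i) as}"
    by auto
  ultimately show ?case
    using J unfolding ideal_on_def by blast
qed

lemma rel_interp_reduced_product:
  assumes J: "ideal_on I J"
    and as: "as \<in> lists (\<Pi>\<^sub>E i\<in>I. universe (M i))"
  shows "rel_interp (reduced_product I J M) r (map (\<lambda>a. red_rel I J M `` {a}) as) \<longleftrightarrow>
    {i \<in> I. \<not> rel_interp (M i) r (map (\<lambda>a. a i) as)} \<in> J"
proof -
  define h where "h i = map (\<lambda>c. red_rep c i) (map (\<lambda>a. red_rel I J M `` {a}) as)" for i
  define D where "D = {i \<in> I. h i \<noteq> map (\<lambda>a. a i) as}"
  have D: "D \<in> J"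
    using red_rep_diff[OF J as] unfolding D_def h_def .
  have absorb: "A \<in> J" if "B \<in> J" "A \<subseteq> B \<union> D" for A B
    using J D that unfolding ideal_on_def by blast
  have "{i \<in> I. \<not> rel_interp (M i) r (h i)} \<in> J \<longleftrightarrow>
      {i \<in> I. \<not> rel_interp (M i) r (map (\<lambda>a. a i) as)} \<in> J"
    by (rule iffI; erule absorb) (auto simp: D_def)
  then show ?thesis
    by (simp add: reduced_product_def h_def)
qed

lemma fun_interp_reduced_product:
  assumes J: "ideal_on I J"
    and M: "\<forall>i\<in>I. is_structure L (M i)"
    and f: "f \<in> funs L" "length as = fun_arity L f"
    and as: "as \<in> lists (\<Pi>\<^sub>E i\<in>I. universe (M i))"
  shows "fun_interp (reduced_product I J M) f (map (\<lambda>a. red_rel I J M `` {a}) as) =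
    red_rel I J M `` {\<lambda>i\<in>I. fun_interp (M i) f (map (\<lambda>a. a i) as)}"
proof -
  define h where "h i = map (\<lambda>c. red_rep c i) (map (\<lambda>a. red_rel I J M `` {a}) as)" for i
  have D: "{i \<in> I. h i \<noteq> map (\<lambda>a. a i) as} \<in> J"
    using red_rep_diff[OF J as] unfolding h_def .
  have rep: "red_rep (red_rel I J M `` {a}) \<in> (\<Pi>\<^sub>E i\<in>I. universe (M i))" if "a \<in> set as" for a
  proof -
    have "a \<in> red_rel I J M `` {a}"
        using that as by (intro equiv_class_self[OF equiv_red_rel[OF J]]) auto
    then have "red_rep (red_rel I J M `` {a}) \<in> red_rel I J M `` {a}"
      unfolding red_rep_def by (rule someI[where P = "\<lambda>b. b \<in> red_rel I J M `` {a}"])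
    moreover have "b \<in> (\<Pi>\<^sub>E i\<in>I. universe (M i))" if "b \<in> red_rel I J M `` {a}" for b
      using that by (simp add: red_rel_def)
    ultimately show ?thesis by blast
  qed
  have "fun_interp (M i) f (h i) \<in> universe (M i)" if "i \<in> I" for i
  proof -
    have "h i \<in> lists (universe (M i))"
      using rep that by (force simp: h_def)
    moreover have "length (h i) = fun_arity L f"
      using f by (simp add: h_def)
    ultimately show ?thesis using M f that by (auto simp: is_structure_def)
  qed
  moreover have "fun_interp (M i) f (map (\<lambda>a. a i) as) \<in> universe (M i)" if "i \<in> I" for i
  proof -
    have "map (\<lambda>a. a i) as \<in> lists (universe (M i))"
      using as that by force
    moreover have "length (map (\<lambda>a. a i) as) = fun_arity L f"
      using f by simp
    ultimately show ?thesis using M f that unfolding is_structure_def by blast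
  qed
  moreover have "{i \<in> I. fun_interp (M i) f (h i) \<noteq> fun_interp (M i) f (map (\<lambda>a. a i) as)} \<in> J"
  proof -
    have "{i \<in> I. fun_interp (M i) f (h i) \<noteq> fun_interp (M i) f (map (\<lambda>a. a i) as)} \<subseteq>
        {i \<in> I. h i \<noteq> map (\<lambda>a. a i) as}" by auto
    then show ?thesis using J D unfolding ideal_on_def by blast
  qed
  moreover have "{i \<in> I. (\<lambda>i\<in>I. fun_interp (M i) f (h i)) i \<noteq>
        (\<lambda>i\<in>I. fun_interp (M i) f (map (\<lambda>a. a i) as)) i} =
      {i \<in> I. fun_interp (M i) f (h i) \<noteq> fun_interp (M i) f (map (\<lambda>a. a i) as)}"
    by auto
  ultimately have "(\<lambda>i\<in>I. fun_interp (M i) f (h i), \<lambda>i\<in>I. fun_interp (M i) f (map (\<lambda>a. a i) as))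
      \<in> red_rel I J M"
    unfolding red_rel_def by (simp add: restrict_PiE_iff)
  then have "red_rel I J M `` {\<lambda>i\<in>I. fun_interp (M i) f (h i)} =
      red_rel I J M `` {\<lambda>i\<in>I. fun_interp (M i) f (map (\<lambda>a. a i) as)}"
    by (rule equiv_class_eq[OF equiv_red_rel[OF J]])
  then show ?thesis
    by (simp add: reduced_product_def h_def)
qed

text \<open>
  If every factor has at most \<open>2\<^sup>\<aleph>\<^sup>0\<close> elements, then so does the reduced product, provided that \<open>I\<close>
  has at most \<open>2\<^sup>\<aleph>\<^sup>0\<close> subsets (in particular, if \<open>I\<close> is countable). Without a bound on \<open>I\<close> a
  \<open>2\<^sup>\<aleph>\<^sup>0\<close>-saturated reduced product of such factors can fail to be saturated: let \<open>K\<close> be a set with more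
  than \<open>2\<^sup>\<aleph>\<^sup>0\<close> subsets, let \<open>I = \<omega> \<times> K\<close>, and take the layered ideal of all sets contained in
  \<open>n \<times> K\<close> for some \<open>n\<close>. In the language of one unary predicate \<open>U\<close>, fix \<open>k\<^sub>0 \<in> K\<close> and let the
  factors at \<open>(n, k\<^sub>0)\<close> be \<open>{u, u', v}\<close> with \<open>U = {u, u'}\<close>, and all others \<open>{u, v}\<close> with \<open>U = {u}\<close>.
  The theory of the reduced product \<open>M\<close> is that of an infinite coinfinite predicate, hence stable.
  But \<open>U\<close> has exactly \<open>2\<^sup>\<aleph>\<^sup>0\<close> elements in \<open>M\<close>, whereas \<open>M\<close> has at least \<open>2\<^sup>|\<^sup>K\<^sup>|\<close>, so \<open>M\<close> omits
  the consistent type \<open>{U(x)} \<union> {x \<noteq> a | a. U(a)}\<close> over fewer than \<open>|M|\<close> parameters.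
\<close>

end

theory Submission imports Defs begin

text \<open>
  Call a formula \<^emph>\<open>horn\<close> if it holds in the reduced product iff it holds in almost all factors. Since
  every positive set splits into disjoint positive sets, every formula is equivalent in the product to
  a Boolean combination of horn formulas. If the theory is stable, the same splitting shows that two
  instances \<open>p(x, e)\<close>, \<open>p(x, e')\<close> of a horn formula define equal or disjoint sets. So a complete type
  is determined by countably many instances of horn formulas that it contains, together with the
  negations of all instances of the remaining ones. Layeredness allows to diagonalise along a tree:
  there are \<open>2\<^sup>\<aleph>\<^sup>0\<close> realisations of the positive part, no two of which belong to the same instance of
  a remaining horn formula. Hence each negated instance excludes at most one of them, and fewer than
  \<open>2\<^sup>\<aleph>\<^sup>0\<close> instances leave a realisation of the type.
\<close>

text \<open>The obstacle is the number of parameters: a construction along countably many layers can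
  meet only countably many demands, whereas a type over fewer than continuum many parameters may
  consist of uncountably many formulas. Stability removes the parameters from the demands. On the
  positive side, two instances of a horn formula in the same type meet, hence coincide, so that one
  instance per formula is enough and the countable language leaves countably many. On the negative
  side, the demand of a formula \<open>p\<close> without an instance in the type is put on pairs: no
  two of the constructed elements may share an instance of \<open>p\<close>, whatever its
  parameters. Such parameters can be glued from the factors, so this becomes a demand on the
  coordinates, with one relation per formula. The continuum is the number of branches of the binary
  tree.\<close>

section \<open>Cardinality\<close>

lemma infinite_times_self_eqpoll: "infinite A \<Longrightarrow> A \<times> A \<approx> A"
  by (simp add: eqpoll_iff_card_of_ordIso card_of_Times_same_infinite)

lemma countable_lepoll_infinite: "countable F \<Longrightarrow> infinite A \<Longrightarrow> F \<lesssim> A"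
  by (metis countable_def infinite_le_lepoll lepoll_def lepoll_trans subset_UNIV)

lemma lists_lepoll_infinite:
  assumes "infinite A"
  shows "lists A \<lesssim> A"
proof -
  have "{xs \<in> lists A. length xs = n} \<lesssim> A" for n
  proof (induction n)
    case 0
    then show ?case
      using assms by (intro countable_lepoll_infinite countable_finite) (auto intro: finite_subset[of _ "{[]}"])
  next
    case (Suc n)
    have "{xs \<in> lists A. length xs = Suc n}
        \<subseteq> (\<lambda>(x, xs). x # xs) ` (A \<times> {xs \<in> lists A. length xs = n})"
      by (force simp: length_Suc_conv)
    then have "{xs \<in> lists A. length xs = Suc n} \<lesssim> A \<times> {xs \<in> lists A. length xs = n}"
      by (rule subset_image_lepoll)
    also have "\<dots> \<lesssim> A \<times> A"
      by (intro times_lepoll_mono Suc lepoll_refl)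
    also have "\<dots> \<approx> A"
      by (rule infinite_times_self_eqpoll[OF assms])
    finally show ?case .
  qed
  then have "\<forall>n. \<exists>f. inj_on f {xs \<in> lists A. length xs = n} \<and> f ` {xs \<in> lists A. length xs = n} \<subseteq> A"
    by (simp add: lepoll_def)
  then obtain f where "\<forall>n. inj_on (f n) {xs \<in> lists A. length xs = n} \<and>
      f n ` {xs \<in> lists A. length xs = n} \<subseteq> A"
    unfolding choice_iff by (elim exE) (rule that)
  then have f: "inj_on (f n) {xs \<in> lists A. length xs = n}"
      "f n ` {xs \<in> lists A. length xs = n} \<subseteq> A" for n
    by simp_all
  have "inj_on (\<lambda>xs. (length xs, f (length xs) xs)) (lists A)"
  proof (rule inj_onI)
    fix x y assume "x \<in> lists A" "y \<in> lists A"
      and "(length x, f (length x) x) = (length y, f (length y) y)"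
    then show "x = y"
      using inj_onD[OF f(1)[of "length y"], of x y] by auto
  qed
  moreover have "(\<lambda>xs. (length xs, f (length xs) xs)) ` lists A \<subseteq> (UNIV :: nat set) \<times> A"
    using f(2) by blast
  ultimately have "lists A \<lesssim> (UNIV :: nat set) \<times> A"
    unfolding lepoll_def by blast
  also have "\<dots> \<lesssim> A \<times> A"
    using assms by (intro times_lepoll_mono lepoll_refl) (simp add: infinite_le_lepoll)
  also have "\<dots> \<approx> A"
    by (rule infinite_times_self_eqpoll[OF assms])
  finally show ?thesis .
qed

lemma nat_lesspoll_continuum: "(UNIV :: nat set) \<prec> continuum"
  using lesspoll_Pow_self[of "UNIV :: nat set"] by simp

text \<open>Needed to count pairs of a formula and a list of parameters; \<open>a\<close> is the
  default value of variables without a parameter. For finite \<open>A\<close> there are still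
  infinitely many lists, so that case rests on Cantor's theorem; for infinite \<open>A\<close> the
  lists are no more than the elements of \<open>A\<close>.\<close>

lemma times_lists_lesspoll_continuum:
  assumes "countable F" "A \<prec> continuum"
  shows "F \<times> lists (insert a A) \<prec> continuum"
proof (cases "finite A")
  case True
  then have "countable (F \<times> lists (insert a A))"
    using assms by (intro countable_SIGMA countable_lists) (auto intro: countable_finite)
  then have "F \<times> lists (insert a A) \<lesssim> (UNIV :: nat set)"
    by (intro countable_lepoll_infinite) auto
  then show ?thesis
    using nat_lesspoll_continuum lesspoll_trans1 by blast
next
  case False
  have "F \<times> lists (insert a A) \<lesssim> insert a A \<times> insert a A"
    using False assms(1)
    by (intro times_lepoll_mono lists_lepoll_infinite countable_lepoll_infinite) auto
  also have "\<dots> \<approx> insert a A"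
    using False by (intro infinite_times_self_eqpoll) simp
  also have "\<dots> \<approx> A"
    by (rule infinite_insert_eqpoll[OF False])
  finally show ?thesis
    using assms(2) lesspoll_trans1 by blast
qed

text \<open>A choice function is coded by the disjoint union of the sets of numbers that code its
  values. An infinite \<open>I\<close> absorbs a factor of natural numbers, so the bound on
  \<open>Pow I\<close> carries over to the product of \<open>I\<close> with them; for finite
  \<open>I\<close> that product is countable.\<close>

lemma PiE_lepoll_continuum:
  assumes I: "Pow I \<lesssim> continuum" and U: "\<forall>i\<in>I. U i \<lesssim> continuum"
  shows "(\<Pi>\<^sub>E i\<in>I. U i) \<lesssim> continuum"
proof -
  have "\<forall>i\<in>I. \<exists>g :: 'b \<Rightarrow> nat set. inj_on g (U i)"
    using U by (auto simp: lepoll_def)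
  then obtain g :: "'a \<Rightarrow> 'b \<Rightarrow> nat set" where g: "inj_on (g i) (U i)" if "i \<in> I" for i
    by metis
  have "inj_on (\<lambda>a. {(i, n). i \<in> I \<and> n \<in> g i (a i)}) (\<Pi>\<^sub>E i\<in>I. U i)"
  proof (rule inj_onI)
    fix a b assume a: "a \<in> (\<Pi>\<^sub>E i\<in>I. U i)" and b: "b \<in> (\<Pi>\<^sub>E i\<in>I. U i)"
      and eq: "{(i, n). i \<in> I \<and> n \<in> g i (a i)} = {(i, n). i \<in> I \<and> n \<in> g i (b i)}"
    have "a i = b i" if "i \<in> I" for i
    proof (rule inj_onD[OF g[OF that]])
      show "g i (a i) = g i (b i)"
        using eq that by (auto simp: set_eq_iff)
    qed (use a b that in auto)
    then show "a = b"
      by (rule PiE_ext[OF a b])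
  qed
  then have "(\<Pi>\<^sub>E i\<in>I. U i) \<lesssim> Pow (I \<times> (UNIV :: nat set))"
    unfolding lepoll_def by blast
  also have "\<dots> \<lesssim> continuum"
  proof (cases "finite I")
    case True
    then have "I \<times> (UNIV :: nat set) \<lesssim> (UNIV :: nat set)"
      by (intro countable_lepoll_infinite countable_SIGMA) (auto intro: countable_finite)
    then obtain h :: "'a \<times> nat \<Rightarrow> nat" where "inj_on h (I \<times> (UNIV :: nat set))"
      unfolding lepoll_def by (elim exE conjE) (rule that)
    then have "inj_on (image h) (Pow (I \<times> (UNIV :: nat set)))"
      by (rule inj_on_image_Pow)
    then show ?thesis
      unfolding lepoll_def by (intro exI[of _ "image h"]) simp
  next
    case False
    have "I \<times> (UNIV :: nat set) \<lesssim> I \<times> I"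
      using False by (intro times_lepoll_mono) (auto simp: infinite_le_lepoll)
    also have "\<dots> \<approx> I"
      by (rule infinite_times_self_eqpoll[OF False])
    finally obtain h where h: "inj_on h (I \<times> (UNIV :: nat set))" "h ` (I \<times> UNIV) \<subseteq> I"
      unfolding lepoll_def by (elim exE conjE) (rule that)
    then have "inj_on (image h) (Pow (I \<times> (UNIV :: nat set)))"
      by (intro inj_on_image_Pow)
    moreover have "image h ` Pow (I \<times> (UNIV :: nat set)) \<subseteq> Pow I"
      using h(2) by blast
    ultimately have "Pow (I \<times> (UNIV :: nat set)) \<lesssim> Pow I"
      unfolding lepoll_def by (intro exI[of _ "image h"]) simp
    then show ?thesis
      using I lepoll_trans by blast
  qed
  finally show ?thesis .
qed

text \<open>Applied to the sets that the formulas of a type define in the product, this completes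
  the type over all parameters of the product at once. With sets in place of formulas, completeness
  is membership of \<open>S\<close> or \<open>X - S\<close>.\<close>

lemma finite_intersection_property_ultra:
  assumes "F \<subseteq> Pow X" and "\<And>Q. finite Q \<Longrightarrow> Q \<subseteq> F \<Longrightarrow> \<exists>c\<in>X. \<forall>S\<in>Q. c \<in> S"
  obtains G where "F \<subseteq> G" "\<And>Q. finite Q \<Longrightarrow> Q \<subseteq> G \<Longrightarrow> \<exists>c\<in>X. \<forall>S\<in>Q. c \<in> S"
    "\<And>S. S \<in> G \<or> X - S \<in> G"
proof -
  define fip where "fip G \<longleftrightarrow> (\<forall>Q. finite Q \<and> Q \<subseteq> G \<longrightarrow> (\<exists>c\<in>X. \<forall>S\<in>Q. c \<in> S))" for G
  have "\<exists>G\<in>{G. F \<subseteq> G \<and> fip G}. \<forall>H\<in>{G. F \<subseteq> G \<and> fip G}. G \<subseteq> H \<longrightarrow> H = G"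
  proof (rule subset_Zorn_nonempty)
    show "{G. F \<subseteq> G \<and> fip G} \<noteq> {}"
      using assms(2) by (auto simp: fip_def)
  next
    fix C assume C: "C \<noteq> {}" "subset.chain {G. F \<subseteq> G \<and> fip G} C"
    have "fip (\<Union>C)"
      unfolding fip_def
    proof (intro allI impI, elim conjE)
      fix Q assume "finite Q" "Q \<subseteq> \<Union>C"
      then obtain G where "G \<in> C" "Q \<subseteq> G"
        using C finite_subset_Union_chain by metis
      then show "\<exists>c\<in>X. \<forall>S\<in>Q. c \<in> S"
        using C(2) \<open>finite Q\<close> by (auto simp: subset_chain_def fip_def)
    qed
    moreover have "F \<subseteq> \<Union>C"
      using C unfolding subset_chain_def by blast
    ultimately show "\<Union>C \<in> {G. F \<subseteq> G \<and> fip G}" by simp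
  qed
  then obtain G where "G \<in> {G. F \<subseteq> G \<and> fip G}"
    and "\<forall>H\<in>{G. F \<subseteq> G \<and> fip G}. G \<subseteq> H \<longrightarrow> H = G" ..
  then have G: "F \<subseteq> G" "fip G" and max: "\<And>H. F \<subseteq> H \<Longrightarrow> fip H \<Longrightarrow> G \<subseteq> H \<Longrightarrow> H = G"
    by auto
  \<comment> \<open>Maximality: a set outside \<open>G\<close> is incompatible with finitely many
    members of \<open>G\<close>.\<close>
  have not_fip: "\<exists>Q. finite Q \<and> Q \<subseteq> G \<and> \<not> (\<exists>c\<in>X. c \<in> S \<and> (\<forall>T\<in>Q. c \<in> T))" if "S \<notin> G" for S
  proof -
    have "\<not> fip (insert S G)"
      using max[of "insert S G"] G(1) that by blast
    then obtain Q where Q: "finite Q" "Q \<subseteq> insert S G" "\<not> (\<exists>c\<in>X. \<forall>T\<in>Q. c \<in> T)"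
      unfolding fip_def by blast
    then show ?thesis
      by (intro exI[of _ "Q - {S}"]) blast
  qed
  have "S \<in> G \<or> X - S \<in> G" for S
  proof (rule ccontr)
    assume *: "\<not> (S \<in> G \<or> X - S \<in> G)"
    then obtain Q where Q: "finite Q" "Q \<subseteq> G" "\<not> (\<exists>c\<in>X. c \<in> S \<and> (\<forall>T\<in>Q. c \<in> T))"
      using not_fip[of S] by blast
    obtain Q' where Q': "finite Q'" "Q' \<subseteq> G" "\<not> (\<exists>c\<in>X. c \<in> X - S \<and> (\<forall>T\<in>Q'. c \<in> T))"
      using * not_fip[of "X - S"] by blast
    have "finite (Q \<union> Q') \<and> Q \<union> Q' \<subseteq> G"
      using Q Q' by simp
    then obtain c where "c \<in> X" "\<forall>T\<in>Q \<union> Q'. c \<in> T"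
      using G(2) unfolding fip_def by blast
    then show False
      using Q(3) Q'(3) by blast
  qed
  with G show thesis
    by (intro that[of G]) (simp_all add: fip_def)
qed


section \<open>First-order logic\<close>

lemma finite_fv_tm: "finite (fv_tm t)"
  by (induction t) auto

lemma finite_fv: "finite (fv p)"
  by (induction p) (auto simp: finite_fv_tm)

lemma eval_tm_cong: "(\<And>v. v \<in> fv_tm t \<Longrightarrow> e v = e' v) \<Longrightarrow> eval_tm M e t = eval_tm M e' t"
proof (induction t)
  case (App f ts)
  then have "map (eval_tm M e) ts = map (eval_tm M e') ts"
    by (intro map_cong refl App.IH) auto
  then show ?case by (simp del: map_eq_conv)
qed simp

lemma sat_cong: "(\<And>v. v \<in> fv p \<Longrightarrow> e v = e' v) \<Longrightarrow> sat M e p \<longleftrightarrow> sat M e' p"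
proof (induction p arbitrary: e e')
  case (Eql s t)
  then have "eval_tm M e s = eval_tm M e' s" "eval_tm M e t = eval_tm M e' t"
    by (auto intro!: eval_tm_cong)
  then show ?case by simp
next
  case (Rel r ts)
  then have "map (eval_tm M e) ts = map (eval_tm M e') ts"
    by (intro map_cong refl eval_tm_cong) auto
  then show ?case by (simp del: map_eq_conv)
next
  case (Neg p)
  then have "sat M e p \<longleftrightarrow> sat M e' p"
    by (intro Neg.IH) auto
  then show ?case by simp
next
  case (Conj p q)
  have "sat M e p \<longleftrightarrow> sat M e' p"
    by (rule Conj.IH(1)) (simp add: Conj.prems)
  moreover have "sat M e q \<longleftrightarrow> sat M e' q"
    by (rule Conj.IH(2)) (simp add: Conj.prems)
  ultimately show ?case by simp
next
  case (Exists n p)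
  have "sat M (e(n := a)) p \<longleftrightarrow> sat M (e'(n := a)) p" for a
    by (rule Exists.IH) (simp add: Exists.prems)
  then show ?case by simp
qed

instance tm :: (countable) countable
  by countable_datatype

instance fm :: (countable, countable) countable
  by countable_datatype

lemma set_tm_subset_funs: "wf_tm L t \<Longrightarrow> set_tm t \<subseteq> funs L"
  by (induction t) auto

lemma set_fm_subset: "wf_fm L p \<Longrightarrow> set1_fm p \<subseteq> funs L \<and> set2_fm p \<subseteq> rels L"
  using set_tm_subset_funs by (induction p) (simp_all, blast+)

text \<open>The types of symbols may be uncountable, so formulas are renamed to formulas over
  natural numbers, which form a countable type. The renaming can be undone because a well-formed
  formula mentions only symbols of \<open>L\<close>.\<close>

lemma countable_wf_fm:
  assumes "countable_language L"
  shows "countable {p. wf_fm L p}"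
proof (rule countable_image_inj_on)
  let ?f = "map_fm (to_nat_on (funs L)) (to_nat_on (rels L))"
  let ?g = "map_fm (from_nat_into (funs L)) (from_nat_into (rels L))"
  show "countable (?f ` {p. wf_fm L p})"
    by simp
  show "inj_on ?f {p. wf_fm L p}"
  proof (rule inj_on_inverseI)
    fix p assume "p \<in> {p. wf_fm L p}"
    then have "set1_fm p \<subseteq> funs L" "set2_fm p \<subseteq> rels L"
      using set_fm_subset by blast+
    moreover have "countable (funs L)" "countable (rels L)"
      using assms by (auto simp: countable_language_def)
    ultimately show "?g (?f p) = p"
      unfolding fm.map_comp by (intro fm.map_ident_strong) (simp_all add: subset_iff)
  qed
qed


section \<open>Layered ideals\<close>

lemma ideal_onD:
  assumes "ideal_on I J"
  shows "{} \<in> J" "A \<in> J \<Longrightarrow> A \<subseteq> I" "A \<in> J \<Longrightarrow> B \<subseteq> A \<Longrightarrow> B \<in> J"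
    "A \<in> J \<Longrightarrow> B \<in> J \<Longrightarrow> A \<union> B \<in> J"
  using assms unfolding ideal_on_def by blast+

lemma ideal_on_finite_UN:
  assumes "ideal_on I J" "finite K" "\<And>k. k \<in> K \<Longrightarrow> A k \<in> J"
  shows "(\<Union>k\<in>K. A k) \<in> J"
  using assms(2,3) by (induction K) (auto simp: ideal_onD[OF assms(1)])

text \<open>
  Layeredness provides \<open>B n\<close> with \<open>\<mu> (B n) > n\<close> whenever \<open>T n\<close> is positive, so that a set
  containing infinitely many of these has infinite measure.
\<close>

lemma layered_layers:
  assumes lay: "layered I J" and D: "\<And>n. D n \<in> J" and T: "\<And>n. T n \<subseteq> I"
  obtains C B where "\<And>n. C n \<in> J" "incseq C" "\<And>n. D n \<subseteq> C n" "(\<Union>n. C n) = I"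
    "\<And>n. B n \<subseteq> C (Suc n) - C n" "\<And>n. B n \<subseteq> T n"
    "\<forall>Z X. infinite Z \<longrightarrow> (\<forall>n\<in>Z. T n \<notin> J \<and> B n \<subseteq> X) \<longrightarrow> X \<notin> J"
proof -
  from lay have J: "ideal_on I J" by (simp add: layered_def)
  note J_simps = ideal_onD[OF J]
  from lay obtain \<mu> :: "'a set \<Rightarrow> ennreal" where
    \<mu>: "\<forall>A B. A \<subseteq> B \<and> B \<subseteq> I \<longrightarrow> \<mu> A \<le> \<mu> B"
      "J = {A. A \<subseteq> I \<and> \<mu> A < \<infinity>}"
      "\<forall>A\<subseteq>I. A \<notin> J \<longleftrightarrow> (SUP B \<in> {B. B \<subseteq> A \<and> B \<in> J}. \<mu> B) = \<infinity>"
    unfolding layered_def by (elim conjE exE) (rule that)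
  have mono: "\<mu> A \<le> \<mu> B" if "A \<subseteq> B" "B \<subseteq> I" for A B
    using \<mu>(1) that by simp
  have finite_\<mu>: "\<mu> A < \<infinity>" if "A \<in> J" for A
    using \<mu>(2) that by simp
  have approx: "A \<notin> J \<longleftrightarrow> (SUP B \<in> {B. B \<subseteq> A \<and> B \<in> J}. \<mu> B) = \<infinity>" if "A \<subseteq> I" for A
    using \<mu>(3) that by simp
  from lay obtain \<C> where \<C>: "\<C> \<subseteq> J" "countable \<C>" "\<Union>\<C> = I"
    unfolding layered_def by (elim conjE exE) (rule that)
  \<comment> \<open>The empty set is added so that there is something to enumerate even if the cover
    is empty.\<close>
  define K where "K = from_nat_into (insert {} \<C>)"
  have K: "range K = insert {} \<C>"
    unfolding K_def using \<C>(2) by (intro range_from_nat_into) auto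
  have KJ: "K n \<in> J" for n
  proof -
    have "insert {} \<C> \<subseteq> J"
      using \<C>(1) J_simps(1) by simp
    moreover have "K n \<in> insert {} \<C>"
      by (simp only: K[symmetric] rangeI)
    ultimately show ?thesis by (rule subsetD)
  qed
  have KI: "(\<Union>n. K n) = I"
    unfolding K using \<C>(3) by simp
  \<comment> \<open>Besides the new piece \<open>B\<close>, a stage swallows \<open>K n\<close>,
    which makes the stages exhaust \<open>I\<close>, and a prescribed small set; the index of
    \<open>D\<close> is shifted because the new stage is \<open>C (Suc n)\<close>.\<close>
  define Q where "Q n C C' B \<longleftrightarrow> C \<subseteq> C' \<and> K n \<subseteq> C' \<and> D (Suc n) \<subseteq> C' \<and> B \<subseteq> C' - C \<and> B \<subseteq> T n \<and>
      (T n \<notin> J \<longrightarrow> of_nat n < \<mu> B)" for n C C' B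
  have step: "\<exists>C'. C' \<in> J \<and> (\<exists>B. Q n C C' B)" if C: "C \<in> J" for C n
  proof -
    obtain B where B: "B \<in> J" "B \<subseteq> T n - C" "T n \<notin> J \<longrightarrow> of_nat n < \<mu> B"
    proof (cases "T n \<in> J")
      case True
      then show ?thesis using that[of "{}"] J_simps by auto
    next
      case False
      \<comment> \<open>Removing a small set from a positive set leaves a positive set, which has
        small subsets of arbitrarily large measure.\<close>
      have "T n - C \<notin> J"
        using False C J_simps(3)[of "(T n - C) \<union> C" "T n"] J_simps(4) by blast
      then have "(SUP B \<in> {B. B \<subseteq> T n - C \<and> B \<in> J}. \<mu> B) = \<infinity>"
        using approx[of "T n - C"] T[of n] by blast
      then have "of_nat n < (SUP B \<in> {B. B \<subseteq> T n - C \<and> B \<in> J}. \<mu> B)"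
        by (simp only: infinity_ennreal_def of_nat_less_top)
      then show ?thesis
        unfolding less_SUP_iff using that by blast
    qed
    have "C \<union> K n \<union> D (Suc n) \<union> B \<in> J"
      using B(1) C KJ D by (intro J_simps(4))
    moreover have "Q n C (C \<union> K n \<union> D (Suc n) \<union> B) B"
      using B unfolding Q_def by blast
    ultimately show ?thesis by blast
  qed
  have "\<exists>C. \<forall>n. (C n \<in> J \<and> (n = 0 \<longrightarrow> D 0 \<subseteq> C n)) \<and> (\<exists>B. Q n (C n) (C (Suc n)) B)"
  proof (rule dependent_nat_choice)
    show "\<exists>C. C \<in> J \<and> (0 = (0 :: nat) \<longrightarrow> D 0 \<subseteq> C)"
      using D[of 0] by blast
    fix C and n :: nat assume "C \<in> J \<and> (n = 0 \<longrightarrow> D 0 \<subseteq> C)"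
    then show "\<exists>C'. (C' \<in> J \<and> (Suc n = 0 \<longrightarrow> D 0 \<subseteq> C')) \<and> (\<exists>B. Q n C C' B)"
      using step[of C n] by simp
  qed
  then obtain C where "\<forall>n. (C n \<in> J \<and> (n = 0 \<longrightarrow> D 0 \<subseteq> C n)) \<and> (\<exists>B. Q n (C n) (C (Suc n)) B)" ..
  then have C: "C n \<in> J" and D0: "D 0 \<subseteq> C 0" and "\<forall>n. \<exists>B. Q n (C n) (C (Suc n)) B" for n
    by simp_all
  then obtain B where "\<forall>n. Q n (C n) (C (Suc n)) (B n)"
    unfolding choice_iff by (elim exE) (rule that)
  then have B: "C n \<subseteq> C (Suc n)" "K n \<subseteq> C (Suc n)" "D (Suc n) \<subseteq> C (Suc n)"
      "B n \<subseteq> C (Suc n) - C n" "B n \<subseteq> T n" "T n \<notin> J \<Longrightarrow> of_nat n < \<mu> (B n)" for n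
    by (simp_all add: Q_def)
  show thesis
  proof (rule that)
    show "C n \<in> J" for n by (rule C)
    show "incseq C" using B(1) by (intro incseq_SucI)
    show "D n \<subseteq> C n" for n using D0 B(3) by (cases n) auto
    show "(\<Union>n. C n) = I"
    proof
      show "(\<Union>n. C n) \<subseteq> I"
        using C J_simps(2) by blast
      show "I \<subseteq> (\<Union>n. C n)"
        unfolding KI[symmetric] using B(2) by blast
    qed
    show "B n \<subseteq> C (Suc n) - C n" "B n \<subseteq> T n" for n by (fact B)+
    show "\<forall>Z X. infinite Z \<longrightarrow> (\<forall>n\<in>Z. T n \<notin> J \<and> B n \<subseteq> X) \<longrightarrow> X \<notin> J"
    proof (intro allI impI notI)
      fix Z :: "nat set" and X assume Z: "infinite Z" "\<forall>n\<in>Z. T n \<notin> J \<and> B n \<subseteq> X"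
      assume X: "X \<in> J"
      \<comment> \<open>A small set has finite measure, so by monotonicity the measures of the
        \<open>B n\<close> inside it are bounded.\<close>
      then obtain m :: nat where m: "\<mu> X < of_nat m"
        using finite_\<mu>[OF X] ennreal_Ex_less_of_nat[of "\<mu> X"] by auto
      obtain n where "n \<in> Z" "n \<ge> m"
        using Z(1) by (meson infinite_nat_iff_unbounded_le)
      have "of_nat m \<le> (of_nat n :: ennreal)"
        using \<open>n \<ge> m\<close> by simp
      also have "\<dots> < \<mu> (B n)"
        using Z(2) \<open>n \<in> Z\<close> B(6) by blast
      also have "\<dots> \<le> \<mu> X"
        using Z(2) \<open>n \<in> Z\<close> J_simps(2)[OF X] by (intro mono) auto
      finally show False
        using m by simp
    qed
  qed
qed

text \<open>Each \<open>S l\<close> is served on the layers whose index has residue \<open>l\<close>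
  modulo \<open>m\<close>. These are infinitely many, so the pieces collected from
  \<open>S l\<close> form a positive set, and pieces from different layers are disjoint.\<close>

lemma layered_disjoint_refinement:
  fixes m :: nat
  assumes lay: "layered I J" and S: "\<forall>l<m. S l \<subseteq> I \<and> S l \<notin> J"
  obtains S' where "\<And>l. l < m \<Longrightarrow> S' l \<subseteq> S l \<and> S' l \<notin> J" "\<And>l l'. l \<noteq> l' \<Longrightarrow> S' l \<inter> S' l' = {}"
proof -
  have J: "ideal_on I J" using lay by (simp add: layered_def)
  \<comment> \<open>For \<open>m = 0\<close> the test fails for every \<open>n\<close> and all
    targets are empty.\<close>
  define T where "T n = (if n mod m < m then S (n mod m) else {})" for n
  have T: "T n \<subseteq> I" for n
    using S by (simp add: T_def)
  obtain C B where "\<And>n. C n \<in> J" and C: "incseq C" and "\<And>n. {} \<subseteq> C n" "(\<Union>n. C n) = I"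
    and B: "\<And>n. B n \<subseteq> C (Suc n) - C n" "\<And>n. B n \<subseteq> T n"
    and pos: "\<forall>Z X. infinite Z \<longrightarrow> (\<forall>n\<in>Z. T n \<notin> J \<and> B n \<subseteq> X) \<longrightarrow> X \<notin> J"
    by (rule layered_layers[of I J "\<lambda>_. {}" T, OF lay ideal_onD(1)[OF J] T]) (rule that)
  have disj: "B n \<inter> B n' = {}" if "n < n'" for n n'
  proof -
    have "C (Suc n) \<subseteq> C n'"
      using C that by (simp add: incseqD)
    then show ?thesis using B(1)[of n] B(1)[of n'] by blast
  qed
  have disj: "B n \<inter> B n' = {}" if "n \<noteq> n'" for n n'
    using disj[of n n'] disj[of n' n] that by (cases n n' rule: linorder_cases) auto
  show thesis
  proof (rule that[of "\<lambda>l. \<Union>n\<in>{n. n mod m = l}. B n"])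
    fix l assume l: "l < m"
    have Z: "infinite {n. n mod m = l}"
    proof
      assume "finite {n. n mod m = l}"
      then have "finite ((\<lambda>j. l + m * j) ` UNIV)"
        by (rule finite_subset[rotated]) (use l in auto)
      then show False
        using l by (subst (asm) finite_image_iff) (auto simp: inj_on_def)
    qed
    have "(\<Union>n\<in>{n. n mod m = l}. B n) \<subseteq> S l"
      using B(2) l by (auto simp: T_def split: if_splits)
    moreover have "(\<Union>n\<in>{n. n mod m = l}. B n) \<notin> J"
      by (rule pos[rule_format, OF Z]) (use S l in \<open>auto simp: T_def\<close>)
    ultimately show "(\<Union>n\<in>{n. n mod m = l}. B n) \<subseteq> S l \<and> (\<Union>n\<in>{n. n mod m = l}. B n) \<notin> J"
      by blast
  next
    fix l l' :: nat assume "l \<noteq> l'"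
    show "(\<Union>n\<in>{n. n mod m = l}. B n) \<inter> (\<Union>n\<in>{n. n mod m = l'}. B n) = {}"
    proof (rule equals0I)
      fix i assume "i \<in> (\<Union>n\<in>{n. n mod m = l}. B n) \<inter> (\<Union>n\<in>{n. n mod m = l'}. B n)"
      then obtain n n' where "n mod m = l" "n' mod m = l'" "i \<in> B n" "i \<in> B n'"
        by blast
      with \<open>l \<noteq> l'\<close> disj[of n n'] show False by auto
    qed
  qed
qed

text \<open>
  The \<open>n\<close>-th layer is devoted to the pair of \<open>k \<in> K\<close> and a finite bit string coded by \<open>n\<close>. On this
  layer, \<open>x f\<close> takes the second rather than the first of two \<open>R k\<close>-unrelated values iff the string
  is an initial segment of \<open>f\<close>. The initial segments of \<open>g\<close> that are not initial segments of \<open>f\<close>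
  yield infinitely many layers separating \<open>x f\<close> from \<open>x g\<close>.
\<close>

lemma layered_perfect_tree:
  fixes U :: "'i \<Rightarrow> 'a set" and Y :: "nat \<Rightarrow> 'i \<Rightarrow> 'a set" and K :: "'k set"
  assumes lay: "layered I J" and K: "countable K"
    and U: "\<And>i. i \<in> I \<Longrightarrow> U i \<noteq> {}" and Y: "\<And>n i. Y n i \<subseteq> U i"
    and dec: "\<And>m n i. m \<le> n \<Longrightarrow> Y n i \<subseteq> Y m i"
    and Y_ne: "\<And>n. {i \<in> I. Y n i = {}} \<in> J"
    and pos: "\<And>n k. k \<in> K \<Longrightarrow> {i \<in> I. \<exists>u\<in>Y n i. \<exists>u'\<in>Y n i. \<not> R k i u u'} \<notin> J"
  obtains x :: "nat set \<Rightarrow> 'i \<Rightarrow> 'a" where "\<And>f. x f \<in> (\<Pi>\<^sub>E i\<in>I. U i)"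
    "\<And>f n. {i \<in> I. x f i \<notin> Y n i} \<in> J"
    "\<And>f g k. f \<noteq> g \<Longrightarrow> k \<in> K \<Longrightarrow> {i \<in> I. \<not> R k i (x f i) (x g i)} \<notin> J"
proof -
  have J: "ideal_on I J" using lay by (simp add: layered_def)
  define \<tau> where "\<tau> n = (from_nat n :: nat \<times> bool list)" for n
  define \<kappa> where "\<kappa> n = from_nat_into K (fst (\<tau> n))" for n
  define T where "T n = {i \<in> I. \<exists>u\<in>Y n i. \<exists>u'\<in>Y n i. \<not> R (\<kappa> n) i u u'}" for n
  have T: "T n \<subseteq> I" for n by (auto simp: T_def)
  obtain C B where CJ: "\<And>n. C n \<in> J" and C: "incseq C" and D: "\<And>n. {i \<in> I. Y n i = {}} \<subseteq> C n"
    and CI: "(\<Union>n. C n) = I"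
    and B: "\<And>n. B n \<subseteq> C (Suc n) - C n" "\<And>n. B n \<subseteq> T n"
    and many: "\<forall>Z X. infinite Z \<longrightarrow> (\<forall>n\<in>Z. T n \<notin> J \<and> B n \<subseteq> X) \<longrightarrow> X \<notin> J"
    by (rule layered_layers[of I J "\<lambda>n. {i \<in> I. Y n i = {}}" T, OF lay Y_ne T]) (rule that)
  have C_mono: "i \<in> C n" if "i \<in> C m" "m \<le> n" for i m n
    using incseqD[OF C that(2)] that(1) by blast
  \<comment> \<open>Off \<open>C 0\<close> this is the index of the unique layer
    \<open>C (Suc n) - C n\<close> that contains \<open>i\<close>. Points of \<open>C 0\<close> get
    level 0; there \<open>ok\<close> asks only for membership in \<open>U i\<close>.\<close>
  define lev where "lev i = (LEAST m. i \<in> C (Suc m))" for i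
  have lev_C: "i \<in> C (Suc (lev i))" if i: "i \<in> I" for i
  proof -
    obtain n where "i \<in> C n" using CI i by blast
    then have "i \<in> C (Suc n)" by (rule C_mono) simp
    then show ?thesis unfolding lev_def by (rule LeastI)
  qed
  have lev_ge: "n \<le> lev i" if "i \<in> I" "i \<notin> C n" for i n
  proof (rule ccontr)
    assume "\<not> n \<le> lev i"
    then have "i \<in> C n" using lev_C[OF that(1)] C_mono[of i "Suc (lev i)" n] by simp
    then show False using that(2) by simp
  qed
  have lev_not_C: "i \<notin> C (lev i)" if "i \<notin> C 0" for i
  proof (cases "lev i")
    case (Suc j)
    then have "j < (LEAST m. i \<in> C (Suc m))" by (simp add: lev_def)
    then show ?thesis using Suc by (auto dest: not_less_Least)
  qed (use that in simp)
  have lev_B: "lev i = n" if "i \<in> B n" for i n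
    unfolding lev_def
  proof (rule Least_equality)
    show "i \<in> C (Suc n)" using that B(1) by blast
    fix m assume m: "i \<in> C (Suc m)"
    show "n \<le> m"
    proof (rule ccontr)
      assume "\<not> n \<le> m"
      then have "i \<in> C n" using C_mono[OF m, of n] by simp
      then show False using that B(1) by blast
    qed
  qed
  define ok where "ok i u u' \<longleftrightarrow> u \<in> U i \<and> u' \<in> U i \<and> (i \<notin> C 0 \<longrightarrow> u \<in> Y (lev i) i \<and> u' \<in> Y (lev i) i \<and>
    (i \<in> T (lev i) \<longrightarrow> \<not> R (\<kappa> (lev i)) i u u'))" for i u u'
  have "\<exists>u u'. ok i u u'" if i: "i \<in> I" for i
  proof (cases "i \<in> C 0")
    case True
    then show ?thesis using U[OF i] by (auto simp: ok_def)
  next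
    case False
    show ?thesis
    proof (cases "i \<in> T (lev i)")
      case True
      then obtain u u' where "u \<in> Y (lev i) i" "u' \<in> Y (lev i) i" "\<not> R (\<kappa> (lev i)) i u u'"
        unfolding T_def by blast
      then have "ok i u u'"
        using Y unfolding ok_def by blast
      then show ?thesis by blast
    next
      case T: False
      \<comment> \<open>\<open>C (lev i)\<close> contains every coordinate at which
        \<open>Y (lev i)\<close> is empty, and \<open>i\<close> lies outside it.\<close>
      have "Y (lev i) i \<noteq> {}"
        using lev_not_C[OF False] D i by blast
      then obtain u where "u \<in> Y (lev i) i" by blast
      then have "ok i u u"
        using Y T unfolding ok_def by blast
      then show ?thesis by blast
    qed
  qed
  then obtain u u' where ok: "\<And>i. i \<in> I \<Longrightarrow> ok i (u i) (u' i)"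
    by metis
  define sel where "sel f n \<longleftrightarrow> snd (\<tau> n) = map (\<lambda>j. j \<in> f) [0..<length (snd (\<tau> n))]" for f :: "nat set" and n
  define x where "x f = (\<lambda>i\<in>I. if sel f (lev i) then u' i else u i)" for f
  show thesis
  proof (rule that[of x])
    show "x f \<in> (\<Pi>\<^sub>E i\<in>I. U i)" for f
      using ok by (auto simp: x_def ok_def)
  next
    fix f n
    have "{i \<in> I. x f i \<notin> Y n i} \<subseteq> C n"
    proof
      fix i assume i: "i \<in> {i \<in> I. x f i \<notin> Y n i}"
      show "i \<in> C n"
      proof (rule ccontr)
        assume "i \<notin> C n"
        then have "i \<notin> C 0" "n \<le> lev i"
          using C_mono[of i 0 n] lev_ge i by auto
        then have "x f i \<in> Y (lev i) i"
          using ok[of i] i by (auto simp: x_def ok_def)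
        then show False
          using dec[OF \<open>n \<le> lev i\<close>] i by blast
      qed
    qed
    then show "{i \<in> I. x f i \<notin> Y n i} \<in> J"
      by (rule ideal_onD(3)[OF J CJ])
  next
    fix f g :: "nat set" and k assume fg: "f \<noteq> g" and k: "k \<in> K"
    then obtain j where j: "j \<in> f \<longleftrightarrow> j \<notin> g" by blast
    \<comment> \<open>These initial segments of \<open>g\<close> are long enough to include the
      position \<open>j\<close> and so differ from those of \<open>f\<close>. On their layers
      \<open>f\<close> takes \<open>u\<close> and \<open>g\<close> takes \<open>u'\<close>, the
      order in which \<open>ok\<close> negates \<open>R\<close>.\<close>
    define s where "s l = map (\<lambda>j. j \<in> g) [0..<Suc (j + l)]" for l
    define z where "z l = to_nat (to_nat_on K k, s l)" for l
    have \<tau>z: "\<tau> (z l) = (to_nat_on K k, s l)" for l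
      by (simp add: \<tau>_def z_def)
    have \<kappa>z: "\<kappa> (z l) = k" for l
      using K k by (simp add: \<kappa>_def \<tau>z)
    have "inj z"
    proof (rule injI)
      fix l l' assume "z l = z l'"
      then have "\<tau> (z l) = \<tau> (z l')" by simp
      then have "length (s l) = length (s l')" by (simp add: \<tau>z)
      then show "l = l'" by (simp add: s_def)
    qed
    then have inf: "infinite (range z)" by (rule range_inj_infinite)
    have "\<forall>n\<in>range z. T n \<notin> J \<and> B n \<subseteq> {i \<in> I. \<not> R k i (x f i) (x g i)}"
    proof (intro ballI conjI subsetI)
      fix n assume n: "n \<in> range z"
      then obtain l where l: "n = z l" by blast
      show "T n \<notin> J"
        using pos[OF k, of n] by (simp add: T_def l \<kappa>z)
      fix i assume i: "i \<in> B n"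
      then have iT: "i \<in> T n" and iI: "i \<in> I" and iC: "i \<notin> C 0" and lev: "lev i = n"
        using B T C_mono[of i 0 n] lev_B by blast+
      have "\<not> R k i (u i) (u' i)"
        using ok[OF iI] iC iT by (simp add: ok_def lev l \<kappa>z)
      moreover have "sel g n"
        by (simp add: sel_def l \<tau>z s_def)
      moreover have "\<not> sel f n"
        using j by (simp add: sel_def l \<tau>z s_def del: upt_Suc) auto
      ultimately show "i \<in> {i \<in> I. \<not> R k i (x f i) (x g i)}"
        using iI by (simp add: x_def lev)
    qed
    then show "{i \<in> I. \<not> R k i (x f i) (x g i)} \<notin> J"
      using many inf by blast
  qed
qed


section \<open>Reduced products modulo a layered ideal\<close>

lemma eval_tm_in_universe:
  assumes "is_structure L N" "\<And>v. e v \<in> universe N" "wf_tm L t"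
  shows "eval_tm N e t \<in> universe N"
  using assms(3)
proof (induction t)
  case (App f ts)
  then have "map (eval_tm N e) ts \<in> lists (universe N)"
    by auto
  moreover have "f \<in> funs L" "length (map (eval_tm N e) ts) = fun_arity L f"
    using App.prems by auto
  ultimately show ?case
    using assms(1) by (simp add: is_structure_def del: in_lists_conv_set)
qed (simp add: assms(2))

section \<open>Truth in almost all factors, and terms in the product\<close>

locale layered_product =
  fixes I :: "'i set" and J :: "'i set set"
    and L :: "('f, 'r) language" and M :: "'i \<Rightarrow> ('f, 'r, 'a) struct"
  assumes lay: "layered I J" and M: "\<forall>i\<in>I. is_structure L (M i)"
begin

abbreviation Pr :: "('i \<Rightarrow> 'a) set" where
  "Pr \<equiv> \<Pi>\<^sub>E i\<in>I. universe (M i)"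

abbreviation R :: "('f, 'r, ('i \<Rightarrow> 'a) set) struct" where
  "R \<equiv> reduced_product I J M"

definition cls :: "('i \<Rightarrow> 'a) \<Rightarrow> ('i \<Rightarrow> 'a) set" where
  "cls a = red_rel I J M `` {a}"

definition ae :: "('i \<Rightarrow> bool) \<Rightarrow> bool" where
  "ae P \<longleftrightarrow> {i \<in> I. \<not> P i} \<in> J"

lemma J: "ideal_on I J"
  using lay by (simp add: layered_def)

lemma ae_mp: "ae P \<Longrightarrow> (\<And>i. i \<in> I \<Longrightarrow> P i \<Longrightarrow> Q i) \<Longrightarrow> ae Q"
  unfolding ae_def by (erule ideal_onD(3)[OF J]) blast

lemma ae_cong: "(\<And>i. i \<in> I \<Longrightarrow> P i \<longleftrightarrow> Q i) \<Longrightarrow> ae P \<longleftrightarrow> ae Q"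
  using ae_mp[of P Q] ae_mp[of Q P] by blast

lemma ae_conj: "ae P \<Longrightarrow> ae Q \<Longrightarrow> ae (\<lambda>i. P i \<and> Q i)"
proof -
  assume "ae P" "ae Q"
  then have "{i \<in> I. \<not> P i} \<union> {i \<in> I. \<not> Q i} \<in> J"
    unfolding ae_def by (rule ideal_onD(4)[OF J])
  then show "ae (\<lambda>i. P i \<and> Q i)"
    unfolding ae_def by (rule ideal_onD(3)[OF J]) blast
qed

lemma ae_ball:
  assumes "finite K" "\<And>k. k \<in> K \<Longrightarrow> ae (P k)"
  shows "ae (\<lambda>i. \<forall>k\<in>K. P k i)"
proof -
  have "(\<Union>k\<in>K. {i \<in> I. \<not> P k i}) \<in> J"
    using assms by (intro ideal_on_finite_UN[OF J]) (auto simp: ae_def)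
  then show ?thesis
    unfolding ae_def by (rule ideal_onD(3)[OF J]) blast
qed

lemma universe_R: "universe R = cls ` Pr"
  by (auto simp: reduced_product_def quotient_def cls_def)

lemma cls_eq_iff: "a \<in> Pr \<Longrightarrow> b \<in> Pr \<Longrightarrow> cls a = cls b \<longleftrightarrow> ae (\<lambda>i. a i = b i)"
  unfolding cls_def by (subst eq_equiv_class_iff[OF equiv_red_rel[OF J]]) (auto simp: red_rel_def ae_def)

lemma Pr_nonempty: "Pr \<noteq> {}"
  using M by (simp add: PiE_eq_empty_iff is_structure_def)

lemma lift_assignment:
  assumes "range e \<subseteq> universe R"
  obtains e' where "\<And>v. e' v \<in> Pr" "e = (\<lambda>v. cls (e' v))"
proof -
  have "\<forall>v. \<exists>a. a \<in> Pr \<and> e v = cls a"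
    using assms universe_R by blast
  then obtain e' where "\<forall>v. e' v \<in> Pr \<and> e v = cls (e' v)"
    unfolding choice_iff by blast
  then show thesis using that by blast
qed

lemma eval_tm_in_Pr:
  assumes "\<And>v. e v \<in> Pr" "wf_tm L t"
  shows "(\<lambda>i\<in>I. eval_tm (M i) (\<lambda>v. e v i) t) \<in> Pr"
  using assms M PiE_mem[OF assms(1)] by (auto intro!: eval_tm_in_universe[of L])

lemma fun_interp_in_Pr:
  assumes "f \<in> funs L" "length as = fun_arity L f" "as \<in> lists Pr"
  shows "(\<lambda>i\<in>I. fun_interp (M i) f (map (\<lambda>a. a i) as)) \<in> Pr"
proof -
  have "fun_interp (M i) f (map (\<lambda>a. a i) as) \<in> universe (M i)" if i: "i \<in> I" for i
  proof -
    have "map (\<lambda>a. a i) as \<in> lists (universe (M i))"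
      using assms(3) PiE_mem[of _ I "\<lambda>i. universe (M i)", OF _ i] by auto
    moreover have "is_structure L (M i)" using M i by blast
    ultimately show ?thesis
      using assms(1,2) by (simp add: is_structure_def del: in_lists_conv_set)
  qed
  then show ?thesis by simp
qed

lemma is_structure_R: "is_structure L R"
  unfolding is_structure_def
proof (intro conjI ballI impI)
  show "universe R \<noteq> {}"
    using Pr_nonempty by (simp add: universe_R)
  fix f cs assume f: "f \<in> funs L" and cs: "cs \<in> lists (universe R)" "length cs = fun_arity L f"
  have "cs \<in> map cls ` lists Pr"
    using cs(1) unfolding universe_R lists_image .
  then obtain as where as: "as \<in> lists Pr" "cs = map cls as" by blast
  then have "length as = fun_arity L f" using cs(2) by simp
  then have "fun_interp R f cs = cls (\<lambda>i\<in>I. fun_interp (M i) f (map (\<lambda>a. a i) as))"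
    unfolding as(2) using fun_interp_reduced_product[OF J M f _ as(1)] by (simp add: cls_def[abs_def])
  then show "fun_interp R f cs \<in> universe R"
    using fun_interp_in_Pr[OF f \<open>length as = fun_arity L f\<close> as(1)] by (simp add: universe_R)
qed

lemma eval_tm_R:
  assumes e: "\<And>v. e v \<in> Pr" and "wf_tm L t"
  shows "eval_tm R (\<lambda>v. cls (e v)) t = cls (\<lambda>i\<in>I. eval_tm (M i) (\<lambda>v. e v i) t)"
  using assms(2)
proof (induction t)
  case (Var n)
  have "(\<lambda>i\<in>I. e n i) = e n"
    using e[of n] by (rule PiE_restrict)
  then show ?case by simp
next
  case (App f ts)
  let ?as = "map (\<lambda>t. \<lambda>i\<in>I. eval_tm (M i) (\<lambda>v. e v i) t) ts"
  have f: "f \<in> funs L" "length ?as = fun_arity L f" using App.prems by auto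
  have as: "?as \<in> lists Pr"
    using App.prems M PiE_mem[OF e] by (auto intro!: eval_tm_in_universe[of L])
  have "map (eval_tm R (\<lambda>v. cls (e v))) ts = map cls ?as"
    unfolding map_map
  proof (rule map_cong[OF refl])
    fix t assume t: "t \<in> set ts"
    then have "wf_tm L t" using App.prems by simp
    from App.IH[OF t this] show "eval_tm R (\<lambda>v. cls (e v)) t =
        (cls \<circ> (\<lambda>t. \<lambda>i\<in>I. eval_tm (M i) (\<lambda>v. e v i) t)) t"
      by (simp only: comp_apply)
  qed
  then have "eval_tm R (\<lambda>v. cls (e v)) (App f ts)
      = cls (\<lambda>i\<in>I. fun_interp (M i) f (map (\<lambda>a. a i) ?as))"
    using fun_interp_reduced_product[OF J M f as, folded cls_def] by (simp only: eval_tm.simps)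
  also have "(\<lambda>i\<in>I. fun_interp (M i) f (map (\<lambda>a. a i) ?as)) =
      (\<lambda>i\<in>I. eval_tm (M i) (\<lambda>v. e v i) (App f ts))"
    by (rule restrict_ext) (simp add: comp_def)
  finally show ?case .
qed

section \<open>Horn formulas and the theorem of Los\<close>

text \<open>
  The formulas for which the theorem of Los holds modulo \<open>J\<close>. They contain the atomic formulas and
  are closed under conjunction, \<open>\<exists>\<close> and \<open>\<exists>x p \<and> \<forall>x (p \<longrightarrow> q)\<close>; these are Palyutin's h-formulas.
\<close>

definition horn :: "('f, 'r) fm \<Rightarrow> bool" where
  "horn p \<longleftrightarrow> wf_fm L p \<and>
    (\<forall>e. (\<forall>v. e v \<in> Pr) \<longrightarrow> sat R (\<lambda>v. cls (e v)) p = ae (\<lambda>i. sat (M i) (\<lambda>v. e v i) p))"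

lemma horn_sat_upd:
  assumes "horn p" "\<And>v. e v \<in> Pr" "a \<in> Pr"
  shows "sat R ((\<lambda>v. cls (e v))(n := cls a)) p \<longleftrightarrow> ae (\<lambda>i. sat (M i) ((\<lambda>v. e v i)(n := a i)) p)"
proof -
  have "\<forall>v. (e(n := a)) v \<in> Pr" using assms by simp
  then have "sat R (\<lambda>v. cls ((e(n := a)) v)) p = ae (\<lambda>i. sat (M i) (\<lambda>v. (e(n := a)) v i) p)"
    using assms(1) unfolding horn_def by blast
  moreover have "(\<lambda>v. cls ((e(n := a)) v)) = (\<lambda>v. cls (e v))(n := cls a)"
    "(\<lambda>v. (e(n := a)) v i) = (\<lambda>v. e v i)(n := a i)" for i
    by (simp_all add: fun_eq_iff)
  ultimately show ?thesis by simp
qed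

lemma horn_Eql:
  assumes "wf_tm L s" "wf_tm L t"
  shows "horn (Eql s t)"
  unfolding horn_def
proof (intro conjI allI impI)
  fix e :: "nat \<Rightarrow> 'i \<Rightarrow> 'a" assume e: "\<forall>v. e v \<in> Pr"
  have "sat R (\<lambda>v. cls (e v)) (Eql s t) \<longleftrightarrow>
      ae (\<lambda>i. (\<lambda>i\<in>I. eval_tm (M i) (\<lambda>v. e v i) s) i = (\<lambda>i\<in>I. eval_tm (M i) (\<lambda>v. e v i) t) i)"
    using cls_eq_iff[OF eval_tm_in_Pr[OF e[rule_format] assms(1)] eval_tm_in_Pr[OF e[rule_format] assms(2)]]
      eval_tm_R[OF e[rule_format] assms(1)] eval_tm_R[OF e[rule_format] assms(2)]
    by simp
  also have "\<dots> \<longleftrightarrow> ae (\<lambda>i. sat (M i) (\<lambda>v. e v i) (Eql s t))"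
    by (rule ae_cong) simp
  finally show "sat R (\<lambda>v. cls (e v)) (Eql s t) = ae (\<lambda>i. sat (M i) (\<lambda>v. e v i) (Eql s t))" .
qed (use assms in simp)

lemma horn_Rel:
  assumes "wf_fm L (Rel r ts)"
  shows "horn (Rel r ts)"
  unfolding horn_def
proof (intro conjI allI impI)
  fix e :: "nat \<Rightarrow> 'i \<Rightarrow> 'a" assume e: "\<forall>v. e v \<in> Pr"
  let ?as = "map (\<lambda>t. \<lambda>i\<in>I. eval_tm (M i) (\<lambda>v. e v i) t) ts"
  have as: "?as \<in> lists Pr"
    using assms M PiE_mem[OF e[rule_format]] by (auto intro!: eval_tm_in_universe[of L])
  have "map (eval_tm R (\<lambda>v. cls (e v))) ts = map cls ?as"
    unfolding map_map
  proof (rule map_cong[OF refl])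
    fix t assume "t \<in> set ts"
    then have "wf_tm L t" using assms by simp
    from eval_tm_R[OF e[rule_format] this] show "eval_tm R (\<lambda>v. cls (e v)) t =
        (cls \<circ> (\<lambda>t. \<lambda>i\<in>I. eval_tm (M i) (\<lambda>v. e v i) t)) t"
      by (simp only: comp_apply)
  qed
  then have "sat R (\<lambda>v. cls (e v)) (Rel r ts) = ae (\<lambda>i. rel_interp (M i) r (map (\<lambda>a. a i) ?as))"
    using rel_interp_reduced_product[OF J as, folded cls_def] by (simp only: sat.simps ae_def)
  also have "\<dots> = ae (\<lambda>i. sat (M i) (\<lambda>v. e v i) (Rel r ts))"
    by (rule ae_cong) (simp add: comp_def)
  finally show "sat R (\<lambda>v. cls (e v)) (Rel r ts) = ae (\<lambda>i. sat (M i) (\<lambda>v. e v i) (Rel r ts))" .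
qed (use assms in simp)

lemma horn_Conj:
  assumes "horn p" "horn q"
  shows "horn (Conj p q)"
  unfolding horn_def
proof (intro conjI allI impI)
  fix e :: "nat \<Rightarrow> 'i \<Rightarrow> 'a" assume "\<forall>v. e v \<in> Pr"
  then have "sat R (\<lambda>v. cls (e v)) (Conj p q) \<longleftrightarrow>
      ae (\<lambda>i. sat (M i) (\<lambda>v. e v i) p) \<and> ae (\<lambda>i. sat (M i) (\<lambda>v. e v i) q)"
    using assms by (simp add: horn_def)
  also have "\<dots> \<longleftrightarrow> ae (\<lambda>i. sat (M i) (\<lambda>v. e v i) (Conj p q))"
    using ae_conj by (auto elim: ae_mp)
  finally show "sat R (\<lambda>v. cls (e v)) (Conj p q) = ae (\<lambda>i. sat (M i) (\<lambda>v. e v i) (Conj p q))" .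
qed (use assms in \<open>simp add: horn_def\<close>)

text \<open>This plants counterexamples in an element that is good almost everywhere:
  \<open>w\<close> is altered only at coordinates that have a witness.\<close>

lemma choose_in_Pr:
  assumes "w \<in> Pr"
  obtains a where "a \<in> Pr" "\<And>i. i \<in> I \<Longrightarrow> \<exists>u\<in>universe (M i). Q i u \<Longrightarrow> Q i (a i)"
    "\<And>i. \<not> (\<exists>u\<in>universe (M i). Q i u) \<Longrightarrow> a i = w i"
proof -
  define a where "a = (\<lambda>i\<in>I. if \<exists>u\<in>universe (M i). Q i u then SOME u. u \<in> universe (M i) \<and> Q i u else w i)"
  have "(SOME u. u \<in> universe (M i) \<and> Q i u) \<in> universe (M i) \<and> Q i (SOME u. u \<in> universe (M i) \<and> Q i u)"
    if "\<exists>u\<in>universe (M i). Q i u" for i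
    by (rule someI_ex) (use that in blast)
  then show thesis
    using assms by (intro that[of a]) (auto simp: a_def PiE_iff extensional_def)
qed

lemma ae_exists:
  "(\<exists>a\<in>Pr. ae (\<lambda>i. P i (a i))) \<longleftrightarrow> ae (\<lambda>i. \<exists>u\<in>universe (M i). P i u)"
proof (intro iffI; (elim bexE)?)
  fix a assume a: "a \<in> Pr" "ae (\<lambda>i. P i (a i))"
  show "ae (\<lambda>i. \<exists>u\<in>universe (M i). P i u)"
    by (rule ae_mp[OF a(2)]) (use PiE_mem[OF a(1)] in auto)
next
  assume ae: "ae (\<lambda>i. \<exists>u\<in>universe (M i). P i u)"
  obtain w where "w \<in> Pr" using Pr_nonempty by blast
  then obtain a where a: "a \<in> Pr" "\<And>i. i \<in> I \<Longrightarrow> \<exists>u\<in>universe (M i). P i u \<Longrightarrow> P i (a i)"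
    by (rule choose_in_Pr[of w P]) (rule that)
  have "ae (\<lambda>i. P i (a i))"
    by (rule ae_mp[OF ae a(2)])
  then show "\<exists>a\<in>Pr. ae (\<lambda>i. P i (a i))"
    using a(1) by (intro bexI[of _ a])
qed

text \<open>Counterexamples can be collected into one element: replacing a solution \<open>w\<close>
  of \<open>P\<close> by a counterexample to \<open>Q\<close> wherever the factor has one preserves
  \<open>P\<close>. By the left side \<open>Q\<close> then holds almost everywhere, so only a small
  set of factors has a counterexample. The first conjunct provides \<open>w\<close>.\<close>

lemma ae_guard:
  "(\<exists>a\<in>Pr. ae (\<lambda>i. P i (a i))) \<and> \<not> (\<exists>a\<in>Pr. ae (\<lambda>i. P i (a i)) \<and> \<not> ae (\<lambda>i. Q i (a i))) \<longleftrightarrow>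
    ae (\<lambda>i. (\<exists>u\<in>universe (M i). P i u) \<and> \<not> (\<exists>u\<in>universe (M i). P i u \<and> \<not> Q i u))" (is "?l \<longleftrightarrow> ?r")
proof
  assume l: ?l
  then obtain w where w: "w \<in> Pr" "ae (\<lambda>i. P i (w i))" by blast
  obtain a where a: "a \<in> Pr"
      "\<And>i. i \<in> I \<Longrightarrow> \<exists>u\<in>universe (M i). P i u \<and> \<not> Q i u \<Longrightarrow> P i (a i) \<and> \<not> Q i (a i)"
      "\<And>i. \<not> (\<exists>u\<in>universe (M i). P i u \<and> \<not> Q i u) \<Longrightarrow> a i = w i"
    by (rule choose_in_Pr[OF w(1), of "\<lambda>i u. P i u \<and> \<not> Q i u"]) (rule that)
  have "ae (\<lambda>i. P i (a i))"
  proof (rule ae_mp[OF w(2)])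
    fix i assume "i \<in> I" "P i (w i)"
    then show "P i (a i)"
      using a(2)[of i] a(3)[of i] by (cases "\<exists>u\<in>universe (M i). P i u \<and> \<not> Q i u") auto
  qed
  moreover from this have "ae (\<lambda>i. Q i (a i))"
    using l a(1) by blast
  ultimately have "ae (\<lambda>i. P i (a i) \<and> Q i (a i))"
    by (rule ae_conj)
  then show ?r
    by (rule ae_mp) (use a(2) PiE_mem[OF a(1)] in blast)
next
  assume r: ?r
  then have "ae (\<lambda>i. \<exists>u\<in>universe (M i). P i u)"
    by (rule ae_mp) blast
  moreover have "ae (\<lambda>i. Q i (a i))" if "a \<in> Pr" "ae (\<lambda>i. P i (a i))" for a
    by (rule ae_mp[OF ae_conj[OF r that(2)]]) (use PiE_mem[OF that(1)] in blast)
  ultimately show ?l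
    unfolding ae_exists by blast
qed

lemma horn_Exists:
  assumes p: "horn p"
  shows "horn (Exists n p)"
  unfolding horn_def
proof (intro conjI allI impI)
  fix e :: "nat \<Rightarrow> 'i \<Rightarrow> 'a" assume e: "\<forall>v. e v \<in> Pr"
  have "sat R (\<lambda>v. cls (e v)) (Exists n p) \<longleftrightarrow> (\<exists>a\<in>Pr. ae (\<lambda>i. sat (M i) ((\<lambda>v. e v i)(n := a i)) p))"
    using horn_sat_upd[OF p] e by (simp add: universe_R)
  also have "\<dots> \<longleftrightarrow> ae (\<lambda>i. sat (M i) (\<lambda>v. e v i) (Exists n p))"
    by (simp add: ae_exists[where P = "\<lambda>i u. sat (M i) ((\<lambda>v. e v i)(n := u)) p"])
  finally show "sat R (\<lambda>v. cls (e v)) (Exists n p) = ae (\<lambda>i. sat (M i) (\<lambda>v. e v i) (Exists n p))" .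
qed (use p in \<open>simp add: horn_def\<close>)

text \<open>The universal statement alone would not satisfy the theorem of Los: if \<open>p\<close>
  has no solution on a positive set of coordinates, it has none in the product, where the
  implication then holds vacuously, although it may fail on another positive set. The conjunct
  \<open>Exists n p\<close> excludes this.\<close>

definition guard :: "nat \<Rightarrow> ('f, 'r) fm \<Rightarrow> ('f, 'r) fm \<Rightarrow> ('f, 'r) fm" where
  "guard n p q = Conj (Exists n p) (Neg (Exists n (Conj p (Neg q))))"

lemma horn_guard:
  assumes p: "horn p" and q: "horn q"
  shows "horn (guard n p q)"
  unfolding horn_def
proof (intro conjI allI impI)
  fix e :: "nat \<Rightarrow> 'i \<Rightarrow> 'a" assume e: "\<forall>v. e v \<in> Pr"
  have "sat R (\<lambda>v. cls (e v)) (guard n p q) \<longleftrightarrow>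
      (\<exists>a\<in>Pr. ae (\<lambda>i. sat (M i) ((\<lambda>v. e v i)(n := a i)) p)) \<and>
      \<not> (\<exists>a\<in>Pr. ae (\<lambda>i. sat (M i) ((\<lambda>v. e v i)(n := a i)) p) \<and>
        \<not> ae (\<lambda>i. sat (M i) ((\<lambda>v. e v i)(n := a i)) q))"
    using horn_sat_upd[OF p] horn_sat_upd[OF q] e by (simp add: universe_R guard_def)
  also have "\<dots> \<longleftrightarrow> ae (\<lambda>i. sat (M i) (\<lambda>v. e v i) (guard n p q))"
    using ae_guard[where P = "\<lambda>i u. sat (M i) ((\<lambda>v. e v i)(n := u)) p"
        and Q = "\<lambda>i u. sat (M i) ((\<lambda>v. e v i)(n := u)) q"]
    by (simp add: guard_def)
  finally show "sat R (\<lambda>v. cls (e v)) (guard n p q) = ae (\<lambda>i. sat (M i) (\<lambda>v. e v i) (guard n p q))" .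
qed (use p q in \<open>simp add: horn_def guard_def\<close>)

section \<open>Reduction of all formulas to Boolean combinations of horn formulas\<close>

text \<open>
  As positive sets can be made disjoint, counterexamples to the individual \<open>q\<close> can be glued into
  one.
\<close>

lemma exists_horn_dnf:
  assumes c: "horn c" and ns: "\<And>q. q \<in> set ns \<Longrightarrow> horn q" and "range e \<subseteq> universe R"
  shows "(\<exists>a\<in>universe R. sat R (e(n := a)) c \<and> (\<forall>q\<in>set ns. \<not> sat R (e(n := a)) q)) \<longleftrightarrow>
    sat R e (Exists n c) \<and> (\<forall>q\<in>set ns. \<not> sat R e (guard n c q))"
proof
  assume "\<exists>a\<in>universe R. sat R (e(n := a)) c \<and> (\<forall>q\<in>set ns. \<not> sat R (e(n := a)) q)"
  then show "sat R e (Exists n c) \<and> (\<forall>q\<in>set ns. \<not> sat R e (guard n c q))"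
    by (auto simp: guard_def)
next
  assume *: "sat R e (Exists n c) \<and> (\<forall>q\<in>set ns. \<not> sat R e (guard n c q))"
  obtain E where E: "\<And>v. E v \<in> Pr" and e: "e = (\<lambda>v. cls (E v))"
    by (rule lift_assignment[OF assms(3)]) (rule that)
  define P where "P p i u \<longleftrightarrow> sat (M i) ((\<lambda>v. E v i)(n := u)) p" for p i u
  have sat: "sat R (e(n := cls a)) p \<longleftrightarrow> ae (\<lambda>i. P p i (a i))" if "horn p" "a \<in> Pr" for p a
    unfolding e P_def by (rule horn_sat_upd[OF that(1) E that(2)])
  from * obtain w where w: "w \<in> Pr" "ae (\<lambda>i. P c i (w i))"
    using sat[OF c] by (auto simp: universe_R)
  have ex: "\<exists>a\<in>Pr. ae (\<lambda>i. P c i (a i)) \<and> \<not> ae (\<lambda>i. P q i (a i))" if "q \<in> set ns" for q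
  proof -
    have "\<exists>b\<in>universe R. sat R (e(n := b)) c \<and> \<not> sat R (e(n := b)) q"
      using * that by (auto simp: guard_def)
    then show ?thesis
      using sat[OF c] sat[OF ns[OF that]] by (auto simp: universe_R)
  qed
  define a where "a l = (SOME a. a \<in> Pr \<and> ae (\<lambda>i. P c i (a i)) \<and> \<not> ae (\<lambda>i. P (ns ! l) i (a i)))" for l
  have a: "a l \<in> Pr \<and> ae (\<lambda>i. P c i (a l i)) \<and> \<not> ae (\<lambda>i. P (ns ! l) i (a l i))" if "l < length ns" for l
  proof -
    have "\<exists>a. a \<in> Pr \<and> ae (\<lambda>i. P c i (a i)) \<and> \<not> ae (\<lambda>i. P (ns ! l) i (a i))"
      using ex[of "ns ! l"] that unfolding Bex_def by simp
    then show ?thesis unfolding a_def by (rule someI_ex)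
  qed
  define S where "S l = {i \<in> I. \<not> P (ns ! l) i (a l i)}" for l
  have S: "\<forall>l<length ns. S l \<subseteq> I \<and> S l \<notin> J"
    using a by (auto simp: S_def ae_def)
  obtain S' where S': "\<And>l. l < length ns \<Longrightarrow> S' l \<subseteq> S l \<and> S' l \<notin> J"
    and disj: "\<And>l l'. l \<noteq> l' \<Longrightarrow> S' l \<inter> S' l' = {}"
    by (rule layered_disjoint_refinement[OF lay S]) (rule that)
  \<comment> \<open>\<open>x\<close> follows \<open>a l\<close> on the piece \<open>S' l\<close> and
    the solution \<open>w\<close> elsewhere. It satisfies \<open>c\<close> almost everywhere, being
    patched from finitely many solutions, and violates the \<open>l\<close>-th formula on all of
    \<open>S' l\<close>.\<close>
  obtain x where x: "x \<in> Pr"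
      "\<And>i. i \<in> I \<Longrightarrow> \<exists>u\<in>universe (M i). \<exists>l<length ns. i \<in> S' l \<and> u = a l i \<Longrightarrow>
        \<exists>l<length ns. i \<in> S' l \<and> x i = a l i"
      "\<And>i. \<not> (\<exists>u\<in>universe (M i). \<exists>l<length ns. i \<in> S' l \<and> u = a l i) \<Longrightarrow> x i = w i"
    by (rule choose_in_Pr[OF w(1), of "\<lambda>i u. \<exists>l<length ns. i \<in> S' l \<and> u = a l i"]) (rule that)
  have x_cases: "x i = w i \<or> (\<exists>l<length ns. x i = a l i)" if "i \<in> I" for i
    using x(2,3)[of i] that by blast
  have x_S': "x i = a l i" if l: "l < length ns" "i \<in> S' l" for i l
  proof -
    have i: "i \<in> I" using S' S l by blast
    then have "a l i \<in> universe (M i)"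
      using a[OF l(1)] PiE_mem by blast
    then obtain l' where "l' < length ns" "i \<in> S' l'" "x i = a l' i"
      using x(2)[OF i] l by blast
    then show ?thesis using disj[of l l'] l(2) by blast
  qed
  have "ae (\<lambda>i. \<forall>l\<in>{..<length ns}. P c i (a l i))"
    using a by (intro ae_ball) auto
  from ae_conj[OF w(2) this] have "ae (\<lambda>i. P c i (x i))"
  proof (rule ae_mp)
    fix i assume "i \<in> I" "P c i (w i) \<and> (\<forall>l\<in>{..<length ns}. P c i (a l i))"
    then show "P c i (x i)" using x_cases[of i] by auto
  qed
  then have "sat R (e(n := cls x)) c"
    using sat[OF c x(1)] by simp
  moreover have "\<not> sat R (e(n := cls x)) q" if q: "q \<in> set ns" for q
  proof -
    obtain l where l: "l < length ns" "q = ns ! l"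
      using q by (auto simp: in_set_conv_nth)
    have "S' l \<subseteq> {i \<in> I. \<not> P q i (x i)}"
      using S'[OF l(1)] x_S'[OF l(1)] by (auto simp: S_def l(2))
    then have "\<not> ae (\<lambda>i. P q i (x i))"
      using S'[OF l(1)] ideal_onD(3)[OF J] unfolding ae_def by blast
    then show ?thesis using sat[OF ns[OF q] x(1)] by simp
  qed
  ultimately show "\<exists>a\<in>universe R. sat R (e(n := a)) c \<and> (\<forall>q\<in>set ns. \<not> sat R (e(n := a)) q)"
    using x(1) universe_R by blast
qed

text \<open>A disjunctive normal form over horn formulas, which may themselves contain quantifiers.
  A disjunct has a single positive formula \<open>c\<close> because horn formulas are closed under
  conjunction, but a list \<open>ns\<close> of negated ones. Speaking of predicates on assignments
  avoids writing the normal forms as formulas.\<close>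

definition qe :: "((nat \<Rightarrow> ('i \<Rightarrow> 'a) set) \<Rightarrow> bool) \<Rightarrow> bool" where
  "qe P \<longleftrightarrow> (\<exists>D :: (('f, 'r) fm \<times> ('f, 'r) fm list) list.
    (\<forall>(c, ns)\<in>set D. horn c \<and> (\<forall>q\<in>set ns. horn q)) \<and>
    (\<forall>e. range e \<subseteq> universe R \<longrightarrow>
      (P e \<longleftrightarrow> (\<exists>(c, ns)\<in>set D. sat R e c \<and> (\<forall>q\<in>set ns. \<not> sat R e q)))))"

lemma qe_cong: "qe P \<Longrightarrow> (\<And>e. range e \<subseteq> universe R \<Longrightarrow> P e \<longleftrightarrow> Q e) \<Longrightarrow> qe Q"
  unfolding qe_def by (elim exE) (rule exI, auto)

lemma qe_horn: "horn p \<Longrightarrow> qe (\<lambda>e. sat R e p)"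
  unfolding qe_def by (rule exI[of _ "[(p, [])]"]) simp

lemma qe_not_horn: "horn p \<Longrightarrow> qe (\<lambda>e. \<not> sat R e p)"
  unfolding qe_def by (rule exI[of _ "[(Eql (Var 0) (Var 0), [p])]"]) (simp add: horn_Eql)

lemma qe_False: "qe (\<lambda>e. False)"
  unfolding qe_def by (rule exI[of _ "[]"]) simp

lemma qe_True: "qe (\<lambda>e. True)"
  using qe_horn[OF horn_Eql[of "Var 0" "Var 0"]] by simp

lemma qe_disj:
  assumes "qe P" "qe Q"
  shows "qe (\<lambda>e. P e \<or> Q e)"
proof -
  obtain D where D: "\<forall>(c, ns)\<in>set D. horn c \<and> (\<forall>q\<in>set ns. horn q)"
    "\<forall>e. range e \<subseteq> universe R \<longrightarrow> (P e \<longleftrightarrow> (\<exists>(c, ns)\<in>set D. sat R e c \<and> (\<forall>q\<in>set ns. \<not> sat R e q)))"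
    using assms(1) unfolding qe_def by blast
  obtain D' where D': "\<forall>(c, ns)\<in>set D'. horn c \<and> (\<forall>q\<in>set ns. horn q)"
    "\<forall>e. range e \<subseteq> universe R \<longrightarrow> (Q e \<longleftrightarrow> (\<exists>(c, ns)\<in>set D'. sat R e c \<and> (\<forall>q\<in>set ns. \<not> sat R e q)))"
    using assms(2) unfolding qe_def by blast
  show ?thesis
    unfolding qe_def by (rule exI[of _ "D @ D'"]) (simp add: D D' ball_Un bex_Un)
qed

lemma qe_conj:
  assumes "qe P" "qe Q"
  shows "qe (\<lambda>e. P e \<and> Q e)"
proof -
  obtain D where D: "\<forall>(c, ns)\<in>set D. horn c \<and> (\<forall>q\<in>set ns. horn q)"
    "\<forall>e. range e \<subseteq> universe R \<longrightarrow> (P e \<longleftrightarrow> (\<exists>(c, ns)\<in>set D. sat R e c \<and> (\<forall>q\<in>set ns. \<not> sat R e q)))"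
    using assms(1) unfolding qe_def by blast
  obtain D' where D': "\<forall>(c, ns)\<in>set D'. horn c \<and> (\<forall>q\<in>set ns. horn q)"
    "\<forall>e. range e \<subseteq> universe R \<longrightarrow> (Q e \<longleftrightarrow> (\<exists>(c, ns)\<in>set D'. sat R e c \<and> (\<forall>q\<in>set ns. \<not> sat R e q)))"
    using assms(2) unfolding qe_def by blast
  define D'' where "D'' = map (\<lambda>((c, ns), (c', ns')). (Conj c c', ns @ ns')) (List.product D D')"
  have D'': "set D'' = (\<lambda>((c, ns), (c', ns')). (Conj c c', ns @ ns')) ` (set D \<times> set D')"
    by (simp add: D''_def)
  have 1: "\<forall>(c, ns)\<in>set D''. horn c \<and> (\<forall>q\<in>set ns. horn q)"
    unfolding D'' using D(1) D'(1) by (fastforce intro: horn_Conj)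
  have 2: "(\<exists>(c, ns)\<in>set D''. sat R e c \<and> (\<forall>q\<in>set ns. \<not> sat R e q)) \<longleftrightarrow>
      (\<exists>(c, ns)\<in>set D. sat R e c \<and> (\<forall>q\<in>set ns. \<not> sat R e q)) \<and>
      (\<exists>(c, ns)\<in>set D'. sat R e c \<and> (\<forall>q\<in>set ns. \<not> sat R e q))" for e
    unfolding D'' by (simp add: split_beta bex_simps ball_Un) blast
  show ?thesis
    unfolding qe_def by (rule exI[of _ D'']) (simp add: 1 2 D(2) D'(2))
qed

lemma qe_Bex: "(\<And>x. x \<in> set xs \<Longrightarrow> qe (P x)) \<Longrightarrow> qe (\<lambda>e. \<exists>x\<in>set xs. P x e)"
  by (induction xs) (simp_all add: qe_False qe_disj)

lemma qe_Ball: "(\<And>x. x \<in> set xs \<Longrightarrow> qe (P x)) \<Longrightarrow> qe (\<lambda>e. \<forall>x\<in>set xs. P x e)"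
  by (induction xs) (simp_all add: qe_True qe_conj)

lemma qe_not:
  assumes "qe P"
  shows "qe (\<lambda>e. \<not> P e)"
proof -
  obtain D where D: "\<forall>(c, ns)\<in>set D. horn c \<and> (\<forall>q\<in>set ns. horn q)"
    "\<forall>e. range e \<subseteq> universe R \<longrightarrow> (P e \<longleftrightarrow> (\<exists>(c, ns)\<in>set D. sat R e c \<and> (\<forall>q\<in>set ns. \<not> sat R e q)))"
    using assms unfolding qe_def by blast
  have "qe (\<lambda>e. \<forall>d\<in>set D. \<not> sat R e (fst d) \<or> (\<exists>q\<in>set (snd d). sat R e q))"
    using D(1) by (intro qe_Ball qe_disj qe_Bex qe_not_horn qe_horn) auto
  then show ?thesis
    by (rule qe_cong) (use D(2) in \<open>auto simp: split_beta\<close>)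
qed

lemma qe_exists:
  assumes "qe P"
  shows "qe (\<lambda>e. \<exists>a\<in>universe R. P (e(n := a)))"
proof -
  obtain D where D: "\<forall>(c, ns)\<in>set D. horn c \<and> (\<forall>q\<in>set ns. horn q)"
    "\<forall>e. range e \<subseteq> universe R \<longrightarrow> (P e \<longleftrightarrow> (\<exists>(c, ns)\<in>set D. sat R e c \<and> (\<forall>q\<in>set ns. \<not> sat R e q)))"
    using assms unfolding qe_def by blast
  have "qe (\<lambda>e. \<exists>d\<in>set D. sat R e (Exists n (fst d)) \<and> (\<forall>q\<in>set (snd d). \<not> sat R e (guard n (fst d) q)))"
    using D(1) by (intro qe_Bex qe_conj qe_Ball qe_not_horn qe_horn horn_Exists horn_guard) auto
  then show ?thesis
  proof (rule qe_cong)
    fix e :: "nat \<Rightarrow> ('i \<Rightarrow> 'a) set" assume e: "range e \<subseteq> universe R"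
    have "(\<exists>a\<in>universe R. P (e(n := a))) \<longleftrightarrow>
        (\<exists>a\<in>universe R. \<exists>d\<in>set D. sat R (e(n := a)) (fst d) \<and> (\<forall>q\<in>set (snd d). \<not> sat R (e(n := a)) q))"
    proof (rule bex_cong[OF refl])
      fix a assume "a \<in> universe R"
      then have "range (e(n := a)) \<subseteq> universe R" using e by auto
      then show "P (e(n := a)) \<longleftrightarrow>
          (\<exists>d\<in>set D. sat R (e(n := a)) (fst d) \<and> (\<forall>q\<in>set (snd d). \<not> sat R (e(n := a)) q))"
        using D(2) by (simp add: split_beta)
    qed
    also have "\<dots> \<longleftrightarrow>
        (\<exists>d\<in>set D. \<exists>a\<in>universe R. sat R (e(n := a)) (fst d) \<and> (\<forall>q\<in>set (snd d). \<not> sat R (e(n := a)) q))"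
      by blast
    also have "\<dots> \<longleftrightarrow>
        (\<exists>d\<in>set D. sat R e (Exists n (fst d)) \<and> (\<forall>q\<in>set (snd d). \<not> sat R e (guard n (fst d) q)))"
      by (intro bex_cong refl exists_horn_dnf e) (use D(1) in auto)
    finally show "(\<exists>d\<in>set D. sat R e (Exists n (fst d)) \<and> (\<forall>q\<in>set (snd d). \<not> sat R e (guard n (fst d) q)))
      \<longleftrightarrow> (\<exists>a\<in>universe R. P (e(n := a)))" by (rule sym)
  qed
qed

lemma qe_sat: "wf_fm L p \<Longrightarrow> qe (\<lambda>e. sat R e p)"
proof (induction p)
  case (Eql s t)
  then show ?case by (intro qe_horn horn_Eql) auto
next
  case (Rel r ts)
  then show ?case by (intro qe_horn horn_Rel)
next
  case (Neg p)
  then show ?case using qe_not by simp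
next
  case (Conj p q)
  then show ?case using qe_conj by simp
next
  case (Exists n p)
  then have "qe (\<lambda>e. sat R e p)" by simp
  from qe_exists[OF this, of n] show ?case by simp
qed

section \<open>Stability: instances of a horn formula are equal or disjoint\<close>

lemma is_model_R: "is_model L (theory_of L R) R"
  using is_structure_R by (auto simp: is_model_def theory_of_def)

text \<open>
  If \<open>p(c, e)\<close>, \<open>p(c, e')\<close>, \<open>p(d, e)\<close> hold but \<open>p(d, e')\<close> fails, split the positive set on which it
  fails into \<open>k\<close> positive pieces; with \<open>d\<close> on the first \<open>l\<close> pieces and \<open>c\<close> elsewhere against \<open>e'\<close>
  on the \<open>j\<close>-th piece and \<open>e\<close> elsewhere, \<open>p\<close> orders \<open>k\<close> elements.
\<close>

lemma stable_horn_normal: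
  assumes stable: "stable TYPE(('i \<Rightarrow> 'a) set) L (theory_of L R)" and p: "horn p"
    and e: "range e \<subseteq> universe R" "range e' \<subseteq> universe R" and cd: "c \<in> universe R" "d \<in> universe R"
    and sat: "sat R (e(0 := c)) p" "sat R (e'(0 := c)) p" "sat R (e(0 := d)) p"
  shows "sat R (e'(0 := d)) p"
proof (rule ccontr)
  assume not_sat: "\<not> sat R (e'(0 := d)) p"
  obtain E where E: "\<And>v. E v \<in> Pr" and eE: "e = (\<lambda>v. cls (E v))"
    by (rule lift_assignment[OF e(1)]) (rule that)
  obtain E' where E': "\<And>v. E' v \<in> Pr" and eE': "e' = (\<lambda>v. cls (E' v))"
    by (rule lift_assignment[OF e(2)]) (rule that)
  obtain C D where C: "C \<in> Pr" "c = cls C" and D: "D \<in> Pr" "d = cls D"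
    using cd universe_R by auto
  define P where "P E u i \<longleftrightarrow> sat (M i) ((\<lambda>v. E v i)(0 := u)) p" for E :: "nat \<Rightarrow> 'i \<Rightarrow> 'a" and u i
  have P: "sat R ((\<lambda>v. cls (E v))(0 := cls a)) p \<longleftrightarrow> ae (\<lambda>i. P E (a i) i)"
    if "\<And>v. E v \<in> Pr" "a \<in> Pr" for E a
    unfolding P_def by (rule horn_sat_upd[OF p that])
  have good: "ae (\<lambda>i. P E (C i) i \<and> P E' (C i) i \<and> P E (D i) i)"
    using sat by (intro ae_conj) (simp_all add: eE eE' C D P[OF E] P[OF E'])
  define S where "S = {i \<in> I. \<not> P E' (D i) i}"
  have S: "S \<subseteq> I \<and> S \<notin> J"
    using not_sat by (auto simp: eE' D P[OF E'] ae_def S_def)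
  have "order_property TYPE(('i \<Rightarrow> 'a) set) L (theory_of L R) {0} p"
    unfolding order_property_def
  proof
    fix k :: nat
    have Sk: "\<forall>l<k. S \<subseteq> I \<and> S \<notin> J"
      using S by simp
    obtain S' where S': "\<And>l. l < k \<Longrightarrow> S' l \<subseteq> S \<and> S' l \<notin> J"
      and disj: "\<And>l l'. l \<noteq> l' \<Longrightarrow> S' l \<inter> S' l' = {}"
      by (rule layered_disjoint_refinement[OF lay, of k "\<lambda>_. S", OF Sk]) (rule that)
    define x where "x l = (\<lambda>i\<in>I. if \<exists>j<l. i \<in> S' j then D i else C i)" for l :: nat
    define y where "y j v = (\<lambda>i\<in>I. if i \<in> S' j then E' v i else E v i)" for j v
    have x: "x l \<in> Pr" for l
      using PiE_mem[OF C(1)] PiE_mem[OF D(1)] by (simp add: x_def)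
    have y: "y j v \<in> Pr" for j v
      using PiE_mem[OF E] PiE_mem[OF E'] by (simp add: y_def)
    have Py: "P (y j) u i \<longleftrightarrow> (if i \<in> S' j then P E' u i else P E u i)" if "i \<in> I" for j u i
      using that by (simp add: P_def y_def)
    have "ae (\<lambda>i. P (y j) (x l i) i) \<longleftrightarrow> l \<le> j" if "l < k" "j < k" for l j
    proof
      assume "l \<le> j"
      show "ae (\<lambda>i. P (y j) (x l i) i)"
      proof (rule ae_mp[OF good])
        fix i assume i: "i \<in> I" and *: "P E (C i) i \<and> P E' (C i) i \<and> P E (D i) i"
        \<comment> \<open>The piece \<open>S' j\<close>, on which the parameters are
          \<open>E'\<close>, is not among the first \<open>l\<close>, so \<open>x l\<close> agrees
          with \<open>C\<close> there. Off it the parameters are \<open>E\<close>, for which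
          \<open>C\<close> and \<open>D\<close> both work.\<close>
        have "\<not> (\<exists>j'<l. i \<in> S' j')" if "i \<in> S' j"
          using disj[of _ j] that \<open>l \<le> j\<close> by (metis IntI empty_iff leD)
        then show "P (y j) (x l i) i"
          using * i by (auto simp: Py x_def)
      qed
    next
      assume ae: "ae (\<lambda>i. P (y j) (x l i) i)"
      show "l \<le> j"
      proof (rule ccontr)
        assume "\<not> l \<le> j"
        then have "S' j \<subseteq> {i \<in> I. \<not> P (y j) (x l i) i}"
          using S'[OF that(2)] by (auto simp: S_def Py x_def)
        then show False
          using ae S'[OF that(2)] ideal_onD(3)[OF J] unfolding ae_def by blast
      qed
    qed
    then have "\<forall>l<k. \<forall>j<k. sat R ((\<lambda>v. cls (y j v))(0 := cls (x l))) p \<longleftrightarrow> l \<le> j"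
      using P[OF y x] by simp
    moreover have "override_on (\<lambda>v. cls (y j v)) (\<lambda>v. cls (x l)) {0} = (\<lambda>v. cls (y j v))(0 := cls (x l))" for j l
      by (auto simp: override_on_def)
    ultimately show "\<exists>(N :: ('f, 'r, ('i \<Rightarrow> 'a) set) struct) a b. is_model L (theory_of L R) N \<and>
        (\<forall>i<k. range (a i) \<subseteq> universe N \<and> range (b i) \<subseteq> universe N) \<and>
        (\<forall>i<k. \<forall>j<k. sat N (override_on (b j) (a i) {0}) p \<longleftrightarrow> i \<le> j)"
      using is_model_R x y
      by (intro exI[of _ R] exI[of _ "\<lambda>l v. cls (x l)"] exI[of _ "\<lambda>j v. cls (y j v)"])
         (auto simp: universe_R)
  qed
  moreover have "wf_fm L p" using p by (simp add: horn_def)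
  ultimately show False
    using stable unfolding stable_def by blast
qed

section \<open>Realisations of a complete type\<close>

definition ext :: "('f, 'r) fm \<Rightarrow> (nat \<Rightarrow> ('i \<Rightarrow> 'a) set) \<Rightarrow> ('i \<Rightarrow> 'a) set set" where
  "ext p e = {c \<in> universe R. sat R (e(0 := c)) p}"

lemma stable_ext_eq:
  assumes "stable TYPE(('i \<Rightarrow> 'a) set) L (theory_of L R)" "horn p"
    and "range e \<subseteq> universe R" "range e' \<subseteq> universe R" "c \<in> ext p e" "c \<in> ext p e'"
  shows "ext p e = ext p e'"
  using stable_horn_normal[OF assms(1,2), of e e' c] stable_horn_normal[OF assms(1,2), of e' e c] assms(3-)
  unfolding ext_def by blast

text \<open>\<open>G\<close> stands for a complete type over all parameters of the product, and
  \<open>Pos\<close> for the horn formulas with an instance in it. The elements come from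
  \<open>layered_perfect_tree\<close>: \<open>Y n\<close> imposes finitely many of the chosen
  positive instances in each factor, and \<open>rel p\<close> relates points of a factor that share
  an instance of \<open>p\<close>.\<close>

lemma many_realisations:
  assumes stable: "stable TYPE(('i \<Rightarrow> 'a) set) L (theory_of L R)" and L: "countable_language L"
    and fip: "\<And>Q. finite Q \<Longrightarrow> Q \<subseteq> G \<Longrightarrow> \<exists>c\<in>universe R. \<forall>S\<in>Q. c \<in> S"
    and ultra: "\<And>S. S \<in> G \<or> universe R - S \<in> G"
  defines "Pos \<equiv> {p. horn p \<and> (\<exists>e. range e \<subseteq> universe R \<and> ext p e \<in> G)}"
  obtains c :: "nat set \<Rightarrow> ('i \<Rightarrow> 'a) set" where "\<And>f. c f \<in> universe R"
    "\<And>f p e. horn p \<Longrightarrow> range e \<subseteq> universe R \<Longrightarrow> ext p e \<in> G \<Longrightarrow> c f \<in> ext p e"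
    "\<And>f g p e. horn p \<Longrightarrow> p \<notin> Pos \<Longrightarrow> range e \<subseteq> universe R \<Longrightarrow> c f \<in> ext p e \<Longrightarrow> c g \<in> ext p e \<Longrightarrow> f = g"
proof -
  note ext_eq = stable_ext_eq[OF stable]
  have "{p. horn p} \<subseteq> {p. wf_fm L p}"
    by (auto simp: horn_def)
  then have countable_horn: "countable {p. horn p}"
    using countable_wf_fm[OF L] countable_subset by blast
  then have countable_Pos: "countable Pos"
    by (rule countable_subset[rotated]) (auto simp: Pos_def)
  define N where "N = {p. horn p} - Pos"
  have countable_N: "countable N"
    unfolding N_def using countable_horn by (rule countable_Diff)
  have "\<exists>E. (\<forall>v. E v \<in> Pr) \<and> ext p (\<lambda>v. cls (E v)) \<in> G" if p: "p \<in> Pos" for p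
  proof -
    obtain e where e: "range e \<subseteq> universe R" "ext p e \<in> G"
      using p unfolding Pos_def by blast
    obtain E where "\<And>v. E v \<in> Pr" "e = (\<lambda>v. cls (E v))"
      by (rule lift_assignment[OF e(1)]) (rule that)
    then show ?thesis using e(2) by blast
  qed
  then obtain E where E: "\<And>p v. p \<in> Pos \<Longrightarrow> E p v \<in> Pr"
    and EG: "\<And>p. p \<in> Pos \<Longrightarrow> ext p (\<lambda>v. cls (E p v)) \<in> G"
    by metis
  have range_E: "range (\<lambda>v. cls (E p v)) \<subseteq> universe R" if "p \<in> Pos" for p
    using E[OF that] universe_R by auto
  define Q where "Q p i u \<longleftrightarrow> sat (M i) ((\<lambda>v. E p v i)(0 := u)) p" for p i u
  have ext_E: "cls a \<in> ext p (\<lambda>v. cls (E p v)) \<longleftrightarrow> ae (\<lambda>i. Q p i (a i))" if "p \<in> Pos" "a \<in> Pr" for p a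
  proof -
    have "horn p" using that by (simp add: Pos_def)
    then show ?thesis
      using horn_sat_upd[of p "E p" a 0] E that by (simp add: ext_def universe_R Q_def)
  qed
  define Pn where "Pn n = {p \<in> Pos. to_nat_on Pos p \<le> n}" for n
  have finite_Pn: "finite (Pn n)" for n
  proof (rule finite_imageD)
    show "finite (to_nat_on Pos ` Pn n)"
      by (rule finite_subset[of _ "{..n}"]) (auto simp: Pn_def)
    show "inj_on (to_nat_on Pos) (Pn n)"
      using inj_on_to_nat_on[OF countable_Pos] by (rule inj_on_subset) (auto simp: Pn_def)
  qed
  have Pn_Pos: "Pn n \<subseteq> Pos" for n
    by (auto simp: Pn_def)
  define Y where "Y n i = {u \<in> universe (M i). \<forall>p\<in>Pn n. Q p i u}" for n i
  \<comment> \<open>The parameters are quantified inside the factor. If \<open>rel p\<close> holds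
    almost everywhere between two elements, the parameters found in the factors glue to an instance
    of \<open>p\<close> in the product that contains both; conversely, a common instance in the
    product yields \<open>rel p\<close> almost everywhere.\<close>
  define rel where "rel p i u u' \<longleftrightarrow> (\<exists>b. range b \<subseteq> universe (M i) \<and>
    sat (M i) (b(0 := u)) p \<and> sat (M i) (b(0 := u')) p)" for p i u u'
  have ae_Y: "ae (\<lambda>i. a i \<in> Y n i)"
    if a: "a \<in> Pr" "\<And>p. p \<in> Pn n \<Longrightarrow> cls a \<in> ext p (\<lambda>v. cls (E p v))" for a n
  proof -
    have "ae (\<lambda>i. \<forall>p\<in>Pn n. Q p i (a i))"
      using a ext_E Pn_Pos by (intro ae_ball finite_Pn) blast
    then show ?thesis
      by (rule ae_mp) (use PiE_mem[OF a(1)] in \<open>simp add: Y_def\<close>)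
  qed
  have common: "\<exists>a\<in>Pr. cls a \<in> S \<and> (\<forall>p\<in>Pn n. cls a \<in> ext p (\<lambda>v. cls (E p v)))" if "S \<in> G" for S n
  proof -
    have "insert S ((\<lambda>p. ext p (\<lambda>v. cls (E p v))) ` Pn n) \<subseteq> G"
      using that EG Pn_Pos by blast
    moreover have "finite (insert S ((\<lambda>p. ext p (\<lambda>v. cls (E p v))) ` Pn n))"
      using finite_Pn by simp
    ultimately obtain c where "c \<in> universe R" "\<forall>T\<in>insert S ((\<lambda>p. ext p (\<lambda>v. cls (E p v))) ` Pn n). c \<in> T"
      using fip by blast
    then show ?thesis unfolding universe_R by auto
  qed
  have univ_G: "universe R \<in> G"
    using ultra[of "{}"] fip[of "{{}}"] by auto
  have Y_ne: "{i \<in> I. Y n i = {}} \<in> J" for n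
  proof -
    obtain a where a: "a \<in> Pr" "\<forall>p\<in>Pn n. cls a \<in> ext p (\<lambda>v. cls (E p v))"
      using common[OF univ_G, of n] by blast
    have "ae (\<lambda>i. Y n i \<noteq> {})"
      by (rule ae_mp[OF ae_Y[OF a(1)]]) (use a(2) in auto)
    then show ?thesis by (simp add: ae_def)
  qed
  have separated: "{i \<in> I. \<exists>u\<in>Y n i. \<exists>u'\<in>Y n i. \<not> rel p i u u'} \<notin> J" if p: "p \<in> N" for n p
  proof
    have hp: "horn p" and not_G: "\<And>e. range e \<subseteq> universe R \<Longrightarrow> ext p e \<notin> G"
      using p by (auto simp: N_def Pos_def)
    obtain a a' where a: "a \<in> Pr" "\<forall>p\<in>Pn n. cls a \<in> ext p (\<lambda>v. cls (E p v))"
      and a': "a' \<in> Pr" "\<forall>p\<in>Pn n. cls a' \<in> ext p (\<lambda>v. cls (E p v))"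
      and no: "\<And>e. range e \<subseteq> universe R \<Longrightarrow> cls a \<in> ext p e \<Longrightarrow> cls a' \<notin> ext p e"
    proof -
      obtain a where a: "a \<in> Pr" "\<forall>p\<in>Pn n. cls a \<in> ext p (\<lambda>v. cls (E p v))"
        using common[OF univ_G, of n] by blast
      show thesis
      proof (cases "\<exists>e. range e \<subseteq> universe R \<and> cls a \<in> ext p e")
        case True
        then obtain e where e: "range e \<subseteq> universe R" "cls a \<in> ext p e" by blast
        \<comment> \<open>\<open>G\<close> omits every instance of \<open>p\<close>, so
          \<open>a'\<close> can be sought in this complement at the same finite stage. By
          disjointness \<open>ext p e\<close> is the only set defined by an instance of
          \<open>p\<close> that contains \<open>a\<close>.\<close>
        have "universe R - ext p e \<in> G"
          using ultra not_G[OF e(1)] by blast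
        from common[OF this, of n] obtain a' where
          a': "a' \<in> Pr" "\<forall>p\<in>Pn n. cls a' \<in> ext p (\<lambda>v. cls (E p v))" "cls a' \<notin> ext p e"
          by blast
        have "cls a' \<notin> ext p e'" if "range e' \<subseteq> universe R" "cls a \<in> ext p e'" for e'
          using ext_eq[OF hp e(1) that(1) e(2) that(2)] a'(3) by simp
        then show thesis using that a a'(1,2) by blast
      next
        case False
        \<comment> \<open>\<open>a\<close> lies in no instance of \<open>p\<close>, so it serves as
          its own partner.\<close>
        then show thesis using that[OF a a] by blast
      qed
    qed
    assume "{i \<in> I. \<exists>u\<in>Y n i. \<exists>u'\<in>Y n i. \<not> rel p i u u'} \<in> J"
    then have "ae (\<lambda>i. \<forall>u\<in>Y n i. \<forall>u'\<in>Y n i. rel p i u u')"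
      by (simp add: ae_def)
    moreover have "ae (\<lambda>i. a i \<in> Y n i \<and> a' i \<in> Y n i)"
      using a a' by (intro ae_conj ae_Y) auto
    ultimately have "ae (\<lambda>i. (\<forall>u\<in>Y n i. \<forall>u'\<in>Y n i. rel p i u u') \<and> a i \<in> Y n i \<and> a' i \<in> Y n i)"
      by (rule ae_conj)
    then have ae_rel: "ae (\<lambda>i. rel p i (a i) (a' i))"
      by (rule ae_mp) blast
    define b where "b i = (SOME b. range b \<subseteq> universe (M i) \<and>
      sat (M i) (b(0 := a i)) p \<and> sat (M i) (b(0 := a' i)) p)" for i
    have b: "range (b i) \<subseteq> universe (M i) \<and>
      sat (M i) ((b i)(0 := a i)) p \<and> sat (M i) ((b i)(0 := a' i)) p" if "rel p i (a i) (a' i)" for i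
      unfolding b_def using that[unfolded rel_def] by (rule someI_ex)
    \<comment> \<open>The default \<open>a i\<close> merely has to lie in the factor; it is used on
      a small set of coordinates.\<close>
    define F where "F v = (\<lambda>i\<in>I. if rel p i (a i) (a' i) then b i v else a i)" for v
    have F: "F v \<in> Pr" for v
      using b[THEN conjunct1] PiE_mem[OF a(1)] by (auto simp: F_def image_subset_iff)
    have Fb: "(\<lambda>v. F v i) = b i" if "i \<in> I" "rel p i (a i) (a' i)" for i
      using that by (simp add: F_def)
    have "ae (\<lambda>i. sat (M i) ((\<lambda>v. F v i)(0 := a i)) p)" "ae (\<lambda>i. sat (M i) ((\<lambda>v. F v i)(0 := a' i)) p)"
      using b by (auto intro!: ae_mp[OF ae_rel] simp: Fb)
    then have "cls a \<in> ext p (\<lambda>v. cls (F v))" "cls a' \<in> ext p (\<lambda>v. cls (F v))"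
      using a(1) a'(1) horn_sat_upd[of p F, OF hp F] by (simp_all add: ext_def universe_R)
    moreover have "range (\<lambda>v. cls (F v)) \<subseteq> universe R"
      using F universe_R by auto
    ultimately show False
      using no by blast
  qed
  obtain x :: "nat set \<Rightarrow> 'i \<Rightarrow> 'a" where x: "\<And>f. x f \<in> Pr" and xY: "\<And>f n. {i \<in> I. x f i \<notin> Y n i} \<in> J"
    and x_rel: "\<And>f g k. f \<noteq> g \<Longrightarrow> k \<in> N \<Longrightarrow> {i \<in> I. \<not> rel k i (x f i) (x g i)} \<notin> J"
  proof (rule layered_perfect_tree[OF lay countable_N, of "\<lambda>i. universe (M i)" Y rel])
    show "universe (M i) \<noteq> {}" if "i \<in> I" for i
      using M that by (auto simp: is_structure_def)
    show "Y n i \<subseteq> universe (M i)" for n i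
      by (auto simp: Y_def)
    show "Y n i \<subseteq> Y m i" if "m \<le> n" for m n i
      using that by (auto simp: Y_def Pn_def)
    show "{i \<in> I. Y n i = {}} \<in> J" for n
      by (rule Y_ne)
    show "{i \<in> I. \<exists>u\<in>Y n i. \<exists>u'\<in>Y n i. \<not> rel k i u u'} \<notin> J" if "k \<in> N" for n k
      using that by (rule separated)
  qed (rule that)
  show thesis
  proof (rule that[of "\<lambda>f. cls (x f)"])
    show "cls (x f) \<in> universe R" for f
      using x universe_R by blast
  next
    fix f p e assume p: "horn p" and e: "range e \<subseteq> universe R" "ext p e \<in> G"
    then have pos: "p \<in> Pos" by (auto simp: Pos_def)
    have "ae (\<lambda>i. x f i \<in> Y (to_nat_on Pos p) i)"
      using xY by (simp add: ae_def)
    then have "ae (\<lambda>i. Q p i (x f i))"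
      by (rule ae_mp) (use pos in \<open>auto simp: Y_def Pn_def\<close>)
    then have "cls (x f) \<in> ext p (\<lambda>v. cls (E p v))"
      using ext_E[OF pos x] by simp
    \<comment> \<open>Both sets belong to \<open>G\<close>, so they meet and therefore
      coincide.\<close>
    moreover have "ext p (\<lambda>v. cls (E p v)) = ext p e"
    proof -
      obtain c where "c \<in> ext p (\<lambda>v. cls (E p v))" "c \<in> ext p e"
        using fip[of "{ext p (\<lambda>v. cls (E p v)), ext p e}"] EG[OF pos] e(2) by auto
      then show ?thesis
        using ext_eq[OF p range_E[OF pos] e(1)] by blast
    qed
    ultimately show "cls (x f) \<in> ext p e" by simp
  next
    fix f g p e assume p: "horn p" "p \<notin> Pos" and e: "range e \<subseteq> universe R"
      and fg: "cls (x f) \<in> ext p e" "cls (x g) \<in> ext p e"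
    obtain F where F: "\<And>v. F v \<in> Pr" and eF: "e = (\<lambda>v. cls (F v))"
      by (rule lift_assignment[OF e]) (rule that)
    have "ae (\<lambda>i. sat (M i) ((\<lambda>v. F v i)(0 := x f i)) p \<and> sat (M i) ((\<lambda>v. F v i)(0 := x g i)) p)"
      using fg horn_sat_upd[of p F, OF p(1) F x] by (intro ae_conj) (simp_all add: ext_def eF)
    then have "ae (\<lambda>i. rel p i (x f i) (x g i))"
    proof (rule ae_mp)
      fix i assume "i \<in> I"
      then have "range (\<lambda>v. F v i) \<subseteq> universe (M i)" using PiE_mem[OF F] by auto
      moreover assume "sat (M i) ((\<lambda>v. F v i)(0 := x f i)) p \<and> sat (M i) ((\<lambda>v. F v i)(0 := x g i)) p"
      ultimately show "rel p i (x f i) (x g i)"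
        unfolding rel_def by blast
    qed
    moreover have "p \<in> N" using p by (simp add: N_def)
    ultimately show "f = g"
      using x_rel[of f g p] unfolding ae_def by blast
  qed
qed

text \<open>By \<open>qe_sat\<close> it suffices to find an element that lies in exactly those horn
  instances over \<open>A\<close> that belong to a completion \<open>G\<close> of the type. Every
  \<open>c f\<close> lies in the positive ones; a violated negative one is recorded by
  \<open>bad\<close> and determines \<open>f\<close>. If every \<open>f\<close> had such a record,
  the continuum would embed into the set of instances over \<open>A\<close>.\<close>

lemma card_saturated_continuum:
  assumes stable: "stable TYPE(('i \<Rightarrow> 'a) set) L (theory_of L R)" and L: "countable_language L"
  shows "card_saturated L continuum R"
  unfolding card_saturated_def
proof (intro allI impI, elim conjE)
  fix A P assume A: "A \<subseteq> universe R" "A \<prec> continuum" and P: "P \<subseteq> param_fms L A" "consistent R P"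
  obtain a0 where a0: "a0 \<in> universe R"
    using is_structure_R by (auto simp: is_structure_def)
  \<comment> \<open>Parameters are given by finite lists padded with \<open>a0\<close>. Assignments
    of all variables are continuum many as soon as there are two parameters, whereas the lists over
    \<open>A\<close> can be counted.\<close>
  define asg where "asg as v = (if v < length as then as ! v else a0)" for as :: "('i \<Rightarrow> 'a) set list" and v
  have asg_range: "range (asg as) \<subseteq> universe R" if "as \<in> lists (insert a0 A)" for as
    using that A(1) a0 by (force simp: asg_def in_lists_conv_set)
  have asg_ex: "\<exists>as\<in>lists (insert a0 A). \<forall>c. sat R (e(0 := c)) p \<longleftrightarrow> sat R ((asg as)(0 := c)) p"
    if "(p, e) \<in> P" for p e
  proof -
    have eA: "\<forall>v\<in>fv p - {0}. e v \<in> A"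
      using that P(1) by (auto simp: param_fms_def)
    obtain m where m: "\<forall>v\<in>fv p. v < m"
      using finite_fv[of p] finite_nat_set_iff_bounded by blast
    define as where "as = map (\<lambda>v. if v \<in> fv p - {0} then e v else a0) [0..<m]"
    have "as \<in> lists (insert a0 A)"
      using eA by (auto simp: as_def)
    moreover have "sat R (e(0 := c)) p \<longleftrightarrow> sat R ((asg as)(0 := c)) p" for c
      by (rule sat_cong) (use m in \<open>auto simp: asg_def as_def\<close>)
    ultimately show ?thesis by blast
  qed
  define F where "F = (\<lambda>(p, e). ext p e) ` P"
  have "\<exists>c\<in>universe R. \<forall>S\<in>Q. c \<in> S" if Q: "finite Q" "Q \<subseteq> F" for Q
  proof -
    obtain P' where P': "finite P'" "P' \<subseteq> P" "Q = (\<lambda>(p, e). ext p e) ` P'"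
      using finite_subset_image[OF Q[unfolded F_def]] by blast
    then obtain c where "realises R c P'"
      using P(2) unfolding consistent_def by blast
    then show ?thesis
      by (intro bexI[of _ c]) (auto simp: P'(3) realises_def ext_def)
  qed
  moreover have "F \<subseteq> Pow (universe R)"
    by (auto simp: F_def ext_def)
  ultimately obtain G where G: "F \<subseteq> G"
    and fip: "\<And>Q. finite Q \<Longrightarrow> Q \<subseteq> G \<Longrightarrow> \<exists>c\<in>universe R. \<forall>S\<in>Q. c \<in> S"
    and ultra: "\<And>S. S \<in> G \<or> universe R - S \<in> G"
    using finite_intersection_property_ultra[of F "universe R"] by metis
  obtain c :: "nat set \<Rightarrow> ('i \<Rightarrow> 'a) set" where c: "\<And>f. c f \<in> universe R"
    and c_pos: "\<And>f p e. horn p \<Longrightarrow> range e \<subseteq> universe R \<Longrightarrow> ext p e \<in> G \<Longrightarrow> c f \<in> ext p e"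
    and c_neg: "\<And>f g p e. horn p \<Longrightarrow> p \<notin> {p. horn p \<and> (\<exists>e. range e \<subseteq> universe R \<and> ext p e \<in> G)} \<Longrightarrow>
      range e \<subseteq> universe R \<Longrightarrow> c f \<in> ext p e \<Longrightarrow> c g \<in> ext p e \<Longrightarrow> f = g"
  proof (rule many_realisations[OF stable L, of G])
    show "\<exists>c\<in>universe R. \<forall>S\<in>Q. c \<in> S" if "finite Q" "Q \<subseteq> G" for Q
      using that by (rule fip)
    show "S \<in> G \<or> universe R - S \<in> G" for S
      by (rule ultra)
  qed (rule that)
  define bad where "bad f p as \<longleftrightarrow> horn p \<and> as \<in> lists (insert a0 A) \<and> ext p (asg as) \<notin> G \<and>
    c f \<in> ext p (asg as)" for f p as
  have bad_inj: "f = g" if bad: "bad f p as" "bad g p as" for f g p as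
  proof (cases "\<exists>e. range e \<subseteq> universe R \<and> ext p e \<in> G")
    case True
    \<comment> \<open>\<open>c f\<close> lies in this instance from \<open>G\<close> as well as in
      the omitted one, so the two coincide, which is absurd.\<close>
    then obtain e where e: "range e \<subseteq> universe R" "ext p e \<in> G" by blast
    then have "c f \<in> ext p e" using c_pos bad(1) by (auto simp: bad_def)
    then have "ext p e = ext p (asg as)"
      using bad(1) asg_range by (intro stable_ext_eq[OF stable _ e(1)]) (auto simp: bad_def)
    then show ?thesis using e(2) bad(1) by (simp add: bad_def)
  next
    case False
    then show ?thesis
      using bad asg_range by (intro c_neg[of p "asg as"]) (auto simp: bad_def)
  qed
  have "\<exists>f. \<forall>p as. \<not> bad f p as"
  proof (rule ccontr)
    assume "\<not> (\<exists>f. \<forall>p as. \<not> bad f p as)"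
    then have "\<forall>f. \<exists>w. bad f (fst w) (snd w)" by auto
    then obtain w where w: "\<forall>f. bad f (fst (w f)) (snd (w f))"
      unfolding choice_iff by (elim exE) (rule that)
    have "inj w"
    proof (rule injI)
      fix f g assume "w f = w g"
      then show "f = g"
        using w[rule_format, of f] w[rule_format, of g] by (intro bad_inj[of f "fst (w f)" "snd (w f)"]) simp_all
    qed
    moreover have "w f \<in> {p. wf_fm L p} \<times> lists (insert a0 A)" for f
      using w[rule_format, of f] unfolding bad_def horn_def mem_Times_iff mem_Collect_eq by blast
    then have "range w \<subseteq> {p. wf_fm L p} \<times> lists (insert a0 A)"
      by (rule image_subsetI)
    ultimately have "continuum \<lesssim> {p. wf_fm L p} \<times> lists (insert a0 A)"
      unfolding lepoll_def by (intro exI[of _ w] conjI)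
    also have "\<dots> \<prec> continuum"
      by (rule times_lists_lesspoll_continuum[OF countable_wf_fm[OF L] A(2)])
    finally show False by simp
  qed
  then obtain f where f: "\<And>p as. \<not> bad f p as" by blast
  have "sat R (e(0 := c f)) p" if pe: "(p, e) \<in> P" for p e
  proof -
    obtain as where as: "as \<in> lists (insert a0 A)"
      and sat_as: "\<And>c. sat R (e(0 := c)) p \<longleftrightarrow> sat R ((asg as)(0 := c)) p"
      using asg_ex[OF pe] by blast
    note range = asg_range[OF as]
    have "wf_fm L p" using pe P(1) by (auto simp: param_fms_def)
    then have "qe (\<lambda>e. sat R e p)" by (rule qe_sat)
    then obtain D where D: "\<forall>(c, ns)\<in>set D. horn c \<and> (\<forall>q\<in>set ns. horn q)"
      and sat_D: "\<forall>e. range e \<subseteq> universe R \<longrightarrow>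
        (sat R e p \<longleftrightarrow> (\<exists>(c, ns)\<in>set D. sat R e c \<and> (\<forall>q\<in>set ns. \<not> sat R e q)))"
      unfolding qe_def by (elim exE conjE) (rule that)
    have sat_iff: "sat R (e(0 := a)) p \<longleftrightarrow>
        (\<exists>d\<in>set D. a \<in> ext (fst d) (asg as) \<and> (\<forall>q\<in>set (snd d). a \<notin> ext q (asg as)))"
      if "a \<in> universe R" for a
    proof -
      have "range ((asg as)(0 := a)) \<subseteq> universe R" using range that by auto
      then show ?thesis
        using sat_D that by (simp add: sat_as ext_def split_beta)
    qed
    have "\<exists>d\<in>set D. ext (fst d) (asg as) \<in> G \<and> (\<forall>q\<in>set (snd d). ext q (asg as) \<notin> G)"
    proof (rule ccontr)
      \<comment> \<open>Otherwise each disjunct is refuted by a single member of \<open>G\<close>,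
        and together with \<open>ext p e\<close> these finitely many members have no common
        point.\<close>
      assume no: "\<not> ?thesis"
      have "\<exists>S\<in>G. \<forall>a\<in>S. \<not> (a \<in> ext (fst d) (asg as) \<and> (\<forall>q\<in>set (snd d). a \<notin> ext q (asg as)))"
        if d: "d \<in> set D" for d
      proof (cases "ext (fst d) (asg as) \<in> G")
        case True
        then obtain q where "q \<in> set (snd d)" "ext q (asg as) \<in> G" using no d by blast
        then show ?thesis by blast
      next
        case False
        then have "universe R - ext (fst d) (asg as) \<in> G" using ultra by blast
        then show ?thesis by blast
      qed
      then obtain S where S: "\<And>d. d \<in> set D \<Longrightarrow> S d \<in> G"
        "\<And>d a. d \<in> set D \<Longrightarrow> a \<in> S d \<Longrightarrow> \<not> (a \<in> ext (fst d) (asg as) \<and> (\<forall>q\<in>set (snd d). a \<notin> ext q (asg as)))"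
        by metis
      have "insert (ext p e) (S ` set D) \<subseteq> G"
        using S(1) G pe by (auto simp: F_def)
      then obtain a where a: "a \<in> universe R" "\<forall>T\<in>insert (ext p e) (S ` set D). a \<in> T"
        using fip[of "insert (ext p e) (S ` set D)"] by auto
      then have "sat R (e(0 := a)) p" by (simp add: ext_def)
      then show False
        using S(2) a(2) sat_iff[OF a(1)] by blast
    qed
    then obtain d where d: "d \<in> set D" "ext (fst d) (asg as) \<in> G"
      "\<And>q. q \<in> set (snd d) \<Longrightarrow> ext q (asg as) \<notin> G" by blast
    have hd: "horn (fst d)" and hn: "\<And>q. q \<in> set (snd d) \<Longrightarrow> horn q"
      using D d(1) by (auto simp: split_beta)
    have "c f \<in> ext (fst d) (asg as)"
      using c_pos[OF hd range d(2)] .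
    moreover have "c f \<notin> ext q (asg as)" if "q \<in> set (snd d)" for q
      using f[of q as] hn[OF that] d(3)[OF that] as by (simp add: bad_def)
    ultimately show ?thesis
      using sat_iff[OF c] d(1) by blast
  qed
  then show "\<exists>c. realises R c P"
    using c by (auto simp: realises_def)
qed

text \<open>The product itself has at most continuum many elements, so a set of parameters smaller
  than the product is smaller than the continuum.\<close>

lemma saturated_if_small:
  assumes "card_saturated L continuum R"
    and "Pow I \<lesssim> continuum" "\<forall>i\<in>I. universe (M i) \<lesssim> continuum"
  shows "saturated L R"
proof -
  have "universe R \<lesssim> Pr"
    unfolding universe_R by (rule image_lepoll)
  also have "Pr \<lesssim> continuum"
    using assms(2,3) by (rule PiE_lepoll_continuum)
  finally have "A \<prec> continuum" if "A \<prec> universe R" for A :: "('i \<Rightarrow> 'a) set set"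
    using that lesspoll_trans2 by blast
  then show ?thesis
    using assms(1) unfolding saturated_def card_saturated_def by blast
qed

end

theorem theorem5p2:
  fixes I :: "'i set" and J :: "'i set set"
    and L :: "('f, 'r) language" and M :: "'i \<Rightarrow> ('f, 'r, 'a) struct"
  assumes "layered I J"
    and "countable_language L"
    and "\<forall>i\<in>I. is_structure L (M i)"
    and "stable TYPE(('i \<Rightarrow> 'a) set) L (theory_of L (reduced_product I J M))"
  shows "card_saturated L continuum (reduced_product I J M) \<and>
    (Pow I \<lesssim> continuum \<and> (\<forall>i\<in>I. universe (M i) \<lesssim> continuum) \<longrightarrow>
      saturated L (reduced_product I J M))"
proof -
  interpret layered_product I J L M
    using assms by unfold_locales
  show ?thesis
    using card_saturated_continuum[OF assms(4,2)] saturated_if_small by blast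
qed

end
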